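(* Let $k$ be a field, $A$ a commutative $k$-algebra, and $$F(x)=x^n-u_1x^{n-1}+\cdots+(-1)^nu_n\in A[x]$$ a monic polynomial of degree $n$. The following six assertions are equivalent: (1) For every maximal ideal $P$ of $A$, with residue map $\varphi\colon A\to\kappa(P)$, every root of $F^\varphi(x)=x^n-\varphi(u_1)x^{n-1}+\cdots+(-1)^n\varphi(u_n)$ in an algebraic closure of $\kappa(P)$ is either zero or transcendental over $k$. (2) For every polynomial $g(x)\in k[x]$ with $g(0)\neq 0$, the element $s_{F,n}(g(t))$ is invertible in $A$. (3) For every polynomial $g(x)\in k[x]$ with $g(0)\neq0$, the class of $g(x)$ in $A[x]/(F(x))$ is invertible. (4) The canonical fraction map $A[x]/(F(x))\to A\otimes_k k[x]_{(x)}/(F(x))$ is an isomorphism. (5) The $A$-module $A\otimes_k k[x]_{(x)}/(F(x))$ is free of rank $n$ with a basis consisting of the classes of $1,x,\dots,x^{n-1}$. (6) For every maximal ideal $P$ of $A$, with residue map $\varphi\colon A\to\kappa(P)$, the $\kappa(P)$-vector space $\kappa(P)\otimes_k k[x]_{(x)}/(F^\varphi(x))$ is $n$-dimensional with a basis consisting of the classes of $1,x,\dots,x^{n-1}$.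
   Context: All rings are commutative with identity. $A[x]=A\otimes_k k[x]$. $k[x]_{(x)}$ denotes the localization of $k[x]$ at the multiplicative set of polynomials $g(x)$ with $g(0)\neq0$; thus $A\otimes_k k[x]_{(x)}$ is the localization of $A[x]$ at that set. For a prime $P$ of $A$, $\kappa(P)=A_P/PA_P$. For a ring map $\varphi\colon A\to K$ and $G(x)=g_0x^m+\cdots+g_m\in A[x]$, $G^\varphi(x)=\varphi(g_0)x^m+\cdots+\varphi(g_m)\in K[x]$. Symmetrizing construction: let $t_1,\dots,t_n$ be variables, and $s_i(t)$ the $i$-th elementary symmetric polynomial in $t_1,\dots,t_n$. For $G(x)\in A[x]$, set $s_i(G(t))=s_i(G(t_1),\dots,G(t_n))$, a symmetric polynomial in $A[t_1,\dots,t_n]$, hence an element of $A[s_1(t),\dots,s_n(t)]$. Let $u\colon A[s_1(t),\dots,s_n(t)]\to A$ be the unique $A$-algebra homomorphism with $u(s_i(t))=u_i$ for $i=1,\dots,n$, and define $s_{F,i}(G(t))=u(s_i(G(t)))\in A$. In particular $s_{F,n}(G(t))=u(G(t_1)\cdots G(t_n))$. *)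

theory Defs
  imports "HOL-Algebra.Algebraic_Closure_Type" "HOL-Library.Poly_Mapping" "HOL-Library.FuncSet"
begin

type_synonym 'a mpoly = "(nat \<Rightarrow>\<^sub>0 nat) \<Rightarrow>\<^sub>0 'a"

definition mpconst :: "'a::comm_ring_1 \<Rightarrow> 'a mpoly" where
  "mpconst c = Poly_Mapping.single 0 c"

definition mpvar :: "nat \<Rightarrow> 'a::comm_ring_1 mpoly" where
  "mpvar j = Poly_Mapping.single (Poly_Mapping.single j 1) 1"

definition mpsubst :: "('a::comm_ring_1 \<Rightarrow> 'b::comm_ring_1) \<Rightarrow> (nat \<Rightarrow> 'b) \<Rightarrow> 'a mpoly \<Rightarrow> 'b" where
  "mpsubst h x Q = (\<Sum>m\<in>Poly_Mapping.keys Q.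
      h (Poly_Mapping.lookup Q m) * (\<Prod>i\<in>Poly_Mapping.keys m. x i ^ Poly_Mapping.lookup m i))"

definition esym :: "nat \<Rightarrow> nat \<Rightarrow> (nat \<Rightarrow> 'b::comm_ring_1) \<Rightarrow> 'b" where
  "esym n i x = (\<Sum>S\<in>{S. S \<subseteq> {1..n} \<and> card S = i}. \<Prod>j\<in>S. x j)"

definition symG :: "nat \<Rightarrow> nat \<Rightarrow> 'a::comm_ring_1 poly \<Rightarrow> 'a mpoly" where
  "symG n i G = esym n i (\<lambda>j. Polynomial.poly (map_poly mpconst G) (mpvar j))"

text \<open>s_{F,i}(G(t)) = u(s_i(G(t))), where u : A[s_1(t),...,s_n(t)] -> A is the A-algebra
  homomorphism with u(s_j(t)) = u_j: write s_i(G(t)) = Q(s_1(t),...,s_n(t)) with Q a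
  polynomial over A in n variables and take Q(u_1,...,u_n).\<close>
definition sF :: "nat \<Rightarrow> (nat \<Rightarrow> 'a::comm_ring_1) \<Rightarrow> nat \<Rightarrow> 'a poly \<Rightarrow> 'a" where
  "sF n u i G = (THE a. \<exists>Q::'a mpoly.
      (\<forall>m\<in>Poly_Mapping.keys Q. Poly_Mapping.keys m \<subseteq> {1..n}) \<and>
      mpsubst mpconst (\<lambda>j. esym n j mpvar) Q = symG n i G \<and>
      a = mpsubst id u Q)"

text \<open>u_i read off from F = x^n - u_1 x^(n-1) + ... + (-1)^n u_n.\<close>
definition uF :: "'a::comm_ring_1 poly \<Rightarrow> nat \<Rightarrow> nat \<Rightarrow> 'a" where
  "uF F n i = (-1) ^ i * Polynomial.coeff F (n - i)"

section \<open>A (x)_k k[x]_(x) / (F) over A (type class ring A, k-algebra via iota)\<close>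

definition Sloc :: "('k::field \<Rightarrow> 'a::comm_ring_1) \<Rightarrow> 'a poly set" where
  "Sloc \<iota> = {map_poly \<iota> g | g. Polynomial.poly g 0 \<noteq> 0}"

definition loc_rel :: "('k::field \<Rightarrow> 'a::comm_ring_1) \<Rightarrow> 'a poly \<Rightarrow> (('a poly \<times> 'a poly) \<times> ('a poly \<times> 'a poly)) set" where
  "loc_rel \<iota> F = {((p, s), (q, t)). s \<in> Sloc \<iota> \<and> t \<in> Sloc \<iota> \<and>
      (\<exists>w\<in>Sloc \<iota>. F dvd w * (p * t - q * s))}"

definition LQ :: "('k::field \<Rightarrow> 'a::comm_ring_1) \<Rightarrow> 'a poly \<Rightarrow> ('a poly \<times> 'a poly) set set" where
  "LQ \<iota> F = (UNIV \<times> Sloc \<iota>) // loc_rel \<iota> F"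

abbreviation frac_class :: "('k::field \<Rightarrow> 'a::comm_ring_1) \<Rightarrow> 'a poly \<Rightarrow> 'a poly \<Rightarrow> 'a poly \<Rightarrow> ('a poly \<times> 'a poly) set" where
  "frac_class \<iota> F p s \<equiv> loc_rel \<iota> F `` {(p, s)}"

section \<open>The same construction over a ring given as an HOL-Algebra structure (used for kappa(P))\<close>

definition SlocR :: "('r, 'm) ring_scheme \<Rightarrow> ('k::field \<Rightarrow> 'r) \<Rightarrow> 'r list set" where
  "SlocR R \<psi> = {ring.normalize R (map \<psi> (rev (coeffs g))) | g. Polynomial.poly g 0 \<noteq> 0}"

definition loc_relR :: "('r, 'm) ring_scheme \<Rightarrow> ('k::field \<Rightarrow> 'r) \<Rightarrow> 'r list \<Rightarrow> (('r list \<times> 'r list) \<times> ('r list \<times> 'r list)) set" where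
  "loc_relR R \<psi> F = {((p, s), (q, t)).
      p \<in> carrier (poly_ring R) \<and> q \<in> carrier (poly_ring R) \<and> s \<in> SlocR R \<psi> \<and> t \<in> SlocR R \<psi> \<and>
      (\<exists>w\<in>SlocR R \<psi>. F divides\<^bsub>poly_ring R\<^esub>
          (w \<otimes>\<^bsub>poly_ring R\<^esub> ((p \<otimes>\<^bsub>poly_ring R\<^esub> t) \<ominus>\<^bsub>poly_ring R\<^esub> (q \<otimes>\<^bsub>poly_ring R\<^esub> s))))}"

definition LQR :: "('r, 'm) ring_scheme \<Rightarrow> ('k::field \<Rightarrow> 'r) \<Rightarrow> 'r list \<Rightarrow> ('r list \<times> 'r list) set set" where
  "LQR R \<psi> F = (carrier (poly_ring R) \<times> SlocR R \<psi>) // loc_relR R \<psi> F"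

text \<open>The polynomial c_0 + c_1 x + ... + c_(n-1) x^(n-1) (lists: highest coefficient first).\<close>
definition poly_of_coeffsR :: "('r, 'm) ring_scheme \<Rightarrow> nat \<Rightarrow> (nat \<Rightarrow> 'r) \<Rightarrow> 'r list" where
  "poly_of_coeffsR R n c = ring.normalize R (rev (map c [0..<n]))"

abbreviation RA :: "'a::comm_ring_1 ring" where
  "RA \<equiv> ring_of_type_algebra"

text \<open>For a maximal ideal P, kappa(P) = A_P / P A_P is canonically A / P.\<close>
definition resfield :: "'a::comm_ring_1 set \<Rightarrow> 'a set ring" where
  "resfield P = RA Quot P"

definition resmap :: "'a::comm_ring_1 set \<Rightarrow> 'a \<Rightarrow> 'a set" where
  "resmap P a = P +>\<^bsub>RA\<^esub> a"

text \<open>F^phi as an HOL-Algebra polynomial (list, highest coefficient first).\<close>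
definition polymap :: "('a::comm_ring_1 \<Rightarrow> 'r) \<Rightarrow> 'a poly \<Rightarrow> 'r list" where
  "polymap \<phi> F = map \<phi> (rev (coeffs F))"

end

theory Submission
  imports Defs "Jordan_Normal_Form.Char_Poly"
begin

text \<open>
  Everything is reduced to condition (3), invertibility of \<open>g\<close> modulo \<open>F\<close>.
  Let \<open>N(g)\<close> be the determinant of multiplication by \<open>g\<close> on the free module \<open>A[x]/(F)\<close>.
  It is multiplicative, and by the adjugate matrix \<open>g\<close> is invertible modulo \<open>F\<close> if and only if
  \<open>N(g)\<close> is a unit. If \<open>F\<close> splits with roots \<open>t\<^sub>i\<close>, then \<open>N(g)\<close> is the product of
  the \<open>g(t\<^sub>i)\<close>; since \<open>N\<close> commutes with ring homomorphisms, applying it to the monic polynomial with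
  indeterminate coefficients identifies \<open>N(g)\<close> with \<open>s\<^sub>F\<^sub>,\<^sub>n(g(t))\<close>.
  A non-unit \<open>N(g)\<close> lies in some maximal ideal \<open>P\<close>, and then \<open>g\<close> is not invertible modulo \<open>(F, P)\<close>,
  so (3) may be tested over the residue fields. There, \<open>g\<close> fails to be invertible modulo \<open>F\<close> exactly
  when both have a common root in an algebraic closure; as \<open>g(0) \<noteq> 0\<close>, such a root is nonzero
  and algebraic over \<open>k\<close>.
\<close>

section \<open>Division by a monic polynomial and the norm\<close>


text \<open>The residue field of \<open>P\<close> is a ring on a carrier set and not a type, whereas
  determinants, remainders and norms live over type-class rings. Computations over it are therefore
  lifted to A[x]: a polynomial over A/P is represented by a preimage, equality becomes membership of
  a difference in P[x], and invertibility of g modulo F becomes the existence of h and q with g h -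
  1 - F q in P[x]. Roots, bases and norms are all related to this one congruence. The norm is what
  leads from all residue fields back to A: inverses found for different P need not fit together, but
  the norm is a single element of A, and an element outside every maximal ideal is a unit. The norm
  also supplies the existence half of the fundamental theorem on symmetric polynomials for
  G(t_1)...G(t_n), by an explicit polynomial in the s_i. Since \<open>sF\<close> is a definite
  description, uniqueness is needed too; it comes from the algebraic independence of the s_i, shown
  by comparing leading monomials.\<close>

definition monic_mod :: "'a::comm_ring_1 poly \<Rightarrow> 'a poly \<Rightarrow> 'a poly" where
  "monic_mod F p = snd (pseudo_divmod p F)"

text \<open>Pseudo-division scales the dividend by a power of the leading coefficient of the
  divisor. For monic \<open>F\<close> that power is 1, so genuine division with remainder is
  available over any commutative ring.\<close>

lemma monic_mod_decomp:
  assumes "Polynomial.lead_coeff F = 1"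
  obtains q where "p = F * q + monic_mod F p"
proof -
  from assms have "F \<noteq> 0" by auto
  moreover obtain q r where qr: "pseudo_divmod p F = (q, r)" by force
  ultimately have "p = F * q + r" using pseudo_divmod(1)[of F p q r] assms by simp
  with qr show ?thesis by (intro that[of q]) (simp add: monic_mod_def)
qed

lemma coeff_monic_mod_eq_0:
  assumes "Polynomial.lead_coeff F = 1" "Polynomial.degree F \<le> i"
  shows "Polynomial.coeff (monic_mod F p) i = 0"
proof -
  from assms have "F \<noteq> 0" by auto
  moreover obtain q r where qr: "pseudo_divmod p F = (q, r)" by force
  ultimately have "r = 0 \<or> Polynomial.degree r < Polynomial.degree F"
    using pseudo_divmod(2)[of F p q r] by simp
  with qr assms show ?thesis by (auto simp: monic_mod_def intro: coeff_eq_0)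
qed

text \<open>Zero divisors do no harm: since \<open>F\<close> is monic, the coefficient of
  \<open>F * q\<close> in degree \<open>degree F + degree q\<close> is exactly the leading
  coefficient of \<open>q\<close>, and the hypothesis makes it vanish.\<close>

lemma monic_mult_small_imp_0:
  fixes F :: "'a::comm_ring_1 poly"
  assumes "Polynomial.lead_coeff F = 1"
    and "\<And>i. Polynomial.degree F \<le> i \<Longrightarrow> Polynomial.coeff (F * q) i = 0"
  shows "q = 0"
  using assms(2)[of "Polynomial.degree F + Polynomial.degree q"] assms(1)
  by (simp add: coeff_mult_degree_sum)

lemma monic_mod_unique:
  fixes F :: "'a::comm_ring_1 poly"
  assumes F: "Polynomial.lead_coeff F = 1" and p: "p = F * q + r"
    and r: "\<And>i. Polynomial.degree F \<le> i \<Longrightarrow> Polynomial.coeff r i = 0"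
  shows "monic_mod F p = r"
proof -
  obtain q' where q': "p = F * q' + monic_mod F p" using monic_mod_decomp[OF F] .
  have eq: "F * (q' - q) = r - monic_mod F p" using p q' by (simp add: algebra_simps)
  have "q' - q = 0"
    by (rule monic_mult_small_imp_0[OF F]) (simp add: eq r coeff_monic_mod_eq_0[OF F])
  with eq show ?thesis by simp
qed

lemma monic_mod_small:
  assumes "Polynomial.lead_coeff F = 1"
    and "\<And>i. Polynomial.degree F \<le> i \<Longrightarrow> Polynomial.coeff r i = 0"
  shows "monic_mod F r = r"
  by (rule monic_mod_unique[where q = 0]) (use assms in auto)

lemma monic_dvd_diff_monic_mod:
  assumes "Polynomial.lead_coeff F = 1"
  shows "F dvd p - monic_mod F p"
  using monic_mod_decomp[OF assms, of p] by (metis add_diff_cancel_right' dvd_triv_left)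

lemma monic_mod_eq_iff:
  assumes F: "Polynomial.lead_coeff F = 1"
  shows "monic_mod F p = monic_mod F q \<longleftrightarrow> F dvd p - q"
proof
  assume eq: "monic_mod F p = monic_mod F q"
  have "p - q = (p - monic_mod F p) - (q - monic_mod F q)" by (simp add: eq)
  then show "F dvd p - q"
    using monic_dvd_diff_monic_mod[OF F] dvd_diff by metis
next
  assume "F dvd p - q"
  then obtain s where s: "p - q = F * s" by (elim dvdE)
  obtain t where t: "q = F * t + monic_mod F q" using monic_mod_decomp[OF F] .
  show "monic_mod F p = monic_mod F q"
    by (rule monic_mod_unique[OF F, where q = "s + t"])
      (use s t in \<open>auto simp: algebra_simps coeff_monic_mod_eq_0[OF F]\<close>)
qed

lemma monic_mod_add:
  assumes F: "Polynomial.lead_coeff F = 1"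
  shows "monic_mod F (p + q) = monic_mod F p + monic_mod F q"
proof -
  obtain s t where "p = F * s + monic_mod F p" "q = F * t + monic_mod F q"
    using monic_mod_decomp[OF F] by metis
  then have "p + q = F * (s + t) + (monic_mod F p + monic_mod F q)" by (simp add: algebra_simps)
  then show ?thesis
    by (rule monic_mod_unique[OF F]) (simp add: coeff_monic_mod_eq_0[OF F])
qed

lemma monic_mod_smult:
  assumes F: "Polynomial.lead_coeff F = 1"
  shows "monic_mod F (Polynomial.smult c p) = Polynomial.smult c (monic_mod F p)"
proof -
  obtain s where "p = F * s + monic_mod F p" using monic_mod_decomp[OF F] .
  then have "Polynomial.smult c p = F * Polynomial.smult c s + Polynomial.smult c (monic_mod F p)"
    by (metis mult_smult_right smult_add_right)
  then show ?thesis
    by (rule monic_mod_unique[OF F]) (simp add: coeff_monic_mod_eq_0[OF F])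
qed

lemma monic_mod_0:
  assumes F: "Polynomial.lead_coeff F = 1"
  shows "monic_mod F 0 = 0"
  by (rule monic_mod_small[OF F]) simp

lemma monic_mod_sum:
  assumes F: "Polynomial.lead_coeff F = 1"
  shows "monic_mod F (\<Sum>i\<in>I. f i) = (\<Sum>i\<in>I. monic_mod F (f i))"
  by (induction I rule: infinite_finite_induct) (auto simp: monic_mod_add[OF F] monic_mod_0[OF F])

lemma monic_mod_mult_right:
  assumes F: "Polynomial.lead_coeff F = 1"
  shows "monic_mod F (g * monic_mod F p) = monic_mod F (g * p)"
proof -
  have "F dvd g * (p - monic_mod F p)" by (intro dvd_mult monic_dvd_diff_monic_mod[OF F])
  then have "monic_mod F (g * p) = monic_mod F (g * monic_mod F p)"
    by (simp add: monic_mod_eq_iff[OF F] right_diff_distrib)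
  then show ?thesis ..
qed

lemma (in comm_ring_hom) lead_coeff_map_poly_monic:
  assumes F: "Polynomial.lead_coeff F = 1"
  shows "Polynomial.degree (map_poly hom F) = Polynomial.degree F"
    and "Polynomial.lead_coeff (map_poly hom F) = 1"
proof -
  show "Polynomial.degree (map_poly hom F) = Polynomial.degree F"
    using F by (intro antisym degree_map_poly_le le_degree) simp
  then show "Polynomial.lead_coeff (map_poly hom F) = 1" using F by simp
qed

lemma (in comm_ring_hom) monic_mod_map_poly:
  assumes F: "Polynomial.lead_coeff F = 1"
  shows "monic_mod (map_poly hom F) (map_poly hom p) = map_poly hom (monic_mod F p)"
proof -
  interpret mp: map_poly_comm_ring_hom hom ..
  obtain q where "p = F * q + monic_mod F p" using monic_mod_decomp[OF F] .
  then have "map_poly hom p = map_poly hom F * map_poly hom q + map_poly hom (monic_mod F p)"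
    by (metis mp.hom_add mp.hom_mult)
  then show ?thesis
    by (rule monic_mod_unique[OF lead_coeff_map_poly_monic(2)[OF F]])
      (simp add: lead_coeff_map_poly_monic(1)[OF F] coeff_monic_mod_eq_0[OF F])
qed

section \<open>The multiplication matrix modulo a monic polynomial and its determinant\<close>

definition mult_mat :: "'a::comm_ring_1 poly \<Rightarrow> 'a poly \<Rightarrow> 'a mat" where
  "mult_mat F g = mat (Polynomial.degree F) (Polynomial.degree F)
     (\<lambda>(i, j). Polynomial.coeff (monic_mod F (g * Polynomial.monom 1 j)) i)"

text \<open>For monic \<open>F\<close> this is the resultant of \<open>F\<close> and
  \<open>g\<close>; as the determinant of a multiplication map it is visibly multiplicative in
  \<open>g\<close>.\<close>

definition poly_norm :: "'a::comm_ring_1 poly \<Rightarrow> 'a poly \<Rightarrow> 'a" where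
  "poly_norm F g = det (mult_mat F g)"

lemma mult_mat_carrier [simp]:
  "mult_mat F g \<in> carrier_mat (Polynomial.degree F) (Polynomial.degree F)"
  by (simp add: mult_mat_def)

lemma poly_eq_sum_monom_lessThan:
  fixes p :: "'a::comm_ring_1 poly"
  assumes "\<And>i. n \<le> i \<Longrightarrow> Polynomial.coeff p i = 0"
  shows "p = (\<Sum>j<n. Polynomial.smult (Polynomial.coeff p j) (Polynomial.monom 1 j))"
proof (rule poly_eqI)
  fix i
  have "(\<Sum>j<n. Polynomial.coeff p j * (if j = i then 1 else 0)) = (if i < n then Polynomial.coeff p i else 0)"
    by (simp add: if_distrib[of "\<lambda>x. _ * x"] cong: if_cong)
  then show "Polynomial.coeff p i = Polynomial.coeff
    (\<Sum>j<n. Polynomial.smult (Polynomial.coeff p j) (Polynomial.monom 1 j)) i"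
    using assms[of i] by (auto simp: coeff_sum)
qed

lemma coeff_monic_mod_mult:
  assumes F: "Polynomial.lead_coeff F = 1"
    and p: "\<And>i. Polynomial.degree F \<le> i \<Longrightarrow> Polynomial.coeff p i = 0"
  shows "Polynomial.coeff (monic_mod F (g * p)) i =
    (\<Sum>j<Polynomial.degree F. Polynomial.coeff (monic_mod F (g * Polynomial.monom 1 j)) i * Polynomial.coeff p j)"
proof -
  have "g * p = (\<Sum>j<Polynomial.degree F. Polynomial.smult (Polynomial.coeff p j) (g * Polynomial.monom 1 j))"
    using arg_cong[OF poly_eq_sum_monom_lessThan[OF p], where f = "\<lambda>p. g * p"]
    by (simp add: sum_distrib_left)
  then show ?thesis
    by (simp add: monic_mod_sum[OF F] monic_mod_smult[OF F] coeff_sum mult.commute)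
qed

text \<open>The columns of the right factor are coefficient vectors of polynomials
  \<open>b j\<close> of degree below \<open>n\<close>; since taking remainders is linear, the
  product has the coefficient vectors of \<open>g * b j\<close> modulo \<open>F\<close> as columns.
  This serves both the multiplicativity of the matrix and the change of basis that splits off a
  linear factor.\<close>

lemma mult_mat_times_cols:
  assumes F: "Polynomial.lead_coeff F = 1" and n: "n = Polynomial.degree F"
    and b: "\<And>i j. n \<le> i \<Longrightarrow> j < m \<Longrightarrow> Polynomial.coeff (b j) i = 0"
  shows "mult_mat F g * mat n m (\<lambda>(i, j). Polynomial.coeff (b j) i) =
    mat n m (\<lambda>(i, j). Polynomial.coeff (monic_mod F (g * b j)) i)"
  by (rule eq_matI)
    (auto simp: mult_mat_def n scalar_prod_def lessThan_atLeast0 b coeff_monic_mod_mult[OF F])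

lemma mult_mat_mult:
  assumes F: "Polynomial.lead_coeff F = 1"
  shows "mult_mat F (g * h) = mult_mat F g * mult_mat F h"
  unfolding mult_mat_def[of F h]
  by (subst mult_mat_times_cols[OF F refl])
    (auto simp: mult_mat_def coeff_monic_mod_eq_0[OF F] monic_mod_mult_right[OF F] mult.assoc)

lemma mult_mat_1:
  assumes F: "Polynomial.lead_coeff F = 1"
  shows "mult_mat F 1 = 1\<^sub>m (Polynomial.degree F)"
  by (rule eq_matI) (auto simp: mult_mat_def monic_mod_small[OF F])

lemma poly_norm_mult:
  assumes F: "Polynomial.lead_coeff F = 1"
  shows "poly_norm F (g * h) = poly_norm F g * poly_norm F h"
  by (simp add: poly_norm_def mult_mat_mult[OF F] det_mult[OF mult_mat_carrier mult_mat_carrier])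

lemma poly_norm_1:
  assumes F: "Polynomial.lead_coeff F = 1"
  shows "poly_norm F 1 = 1"
  by (simp add: poly_norm_def mult_mat_1[OF F])

lemma poly_norm_cong:
  assumes F: "Polynomial.lead_coeff F = 1" and "F dvd g - h"
  shows "poly_norm F g = poly_norm F h"
proof -
  have "F dvd g * m - h * m" for m using assms(2) by (metis dvd_mult2 left_diff_distrib)
  then have "monic_mod F (g * m) = monic_mod F (h * m)" for m by (simp add: monic_mod_eq_iff[OF F])
  then show ?thesis by (simp add: poly_norm_def mult_mat_def)
qed

lemma (in comm_ring_hom) poly_norm_map_poly:
  assumes F: "Polynomial.lead_coeff F = 1"
  shows "poly_norm (map_poly hom F) (map_poly hom g) = hom (poly_norm F g)"
proof -
  interpret mp: map_poly_comm_ring_hom hom ..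
  have "map_poly hom g * Polynomial.monom 1 j = map_poly hom (g * Polynomial.monom 1 j)" for j
    by (simp add: mp.hom_mult)
  then have "mult_mat (map_poly hom F) (map_poly hom g) = map_mat hom (mult_mat F g)"
    by (intro eq_matI)
      (auto simp: mult_mat_def monic_mod_map_poly[OF F] lead_coeff_map_poly_monic(1)[OF F])
  then show ?thesis by (simp add: poly_norm_def)
qed

lemma poly_norm_unit_imp_inverse_mod:
  assumes F: "Polynomial.lead_coeff F = 1" and unit: "poly_norm F g dvd 1"
  shows "\<exists>h. F dvd g * h - 1"
proof (cases "Polynomial.degree F = 0")
  \<comment> \<open>In degree 0 the matrix is empty and has no column 0, but then
    \<open>F = 1\<close> divides everything.\<close>
  case True
  then have "F = 1" using F by (metis degree_eq_zeroE lead_coeff_pCons(2) one_pCons)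
  then show ?thesis by simp
next
  case False
  define n where "n = Polynomial.degree F"
  then have n: "0 < n" using False by simp
  from unit obtain c where c: "poly_norm F g * c = 1" by (metis dvdE)
  \<comment> \<open>The candidate inverse is read off column 0 of the adjugate, the column of the
    basis element 1. There M adj(M) = det(M) I says that \<open>g * h\<close> is congruent modulo
    \<open>F\<close> to the constant \<open>poly_norm F g\<close>; scaling by \<open>c\<close> then
    yields an inverse.\<close>
  define v where "v i = adj_mat (mult_mat F g) $$ (i, 0)" for i
  define h where "h = (\<Sum>i<n. Polynomial.monom (v i) i)"
  have coeff_h: "Polynomial.coeff h i = (if i < n then v i else 0)" for i
    by (simp add: h_def coeff_sum if_distrib)
  have M: "mult_mat F g \<in> carrier_mat n n" by (simp add: n_def)
  have "Polynomial.coeff (monic_mod F (g * h)) i = Polynomial.coeff [:poly_norm F g:] i" for i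
  proof (cases "i < n")
    case True
    have "Polynomial.coeff (monic_mod F (g * h)) i =
      (\<Sum>j<n. Polynomial.coeff (monic_mod F (g * Polynomial.monom 1 j)) i * v j)"
      by (subst coeff_monic_mod_mult[OF F]) (simp_all add: n_def[symmetric] coeff_h)
    also have "\<dots> = (mult_mat F g * adj_mat (mult_mat F g)) $$ (i, 0)"
      using adj_mat(1)[OF M] M True n
      by (simp add: scalar_prod_def lessThan_atLeast0 v_def) (simp add: mult_mat_def n_def)
    also have "\<dots> = Polynomial.coeff [:poly_norm F g:] i"
      using adj_mat(2)[OF M] True n by (simp add: poly_norm_def coeff_pCons split: nat.split)
    finally show ?thesis .
  next
    case False
    with n show ?thesis by (simp add: coeff_monic_mod_eq_0[OF F] n_def coeff_pCons split: nat.split)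
  qed
  then have "monic_mod F (g * h) = [:poly_norm F g:]" by (intro poly_eqI)
  then have "F dvd g * h - [:poly_norm F g:]" using monic_dvd_diff_monic_mod[OF F, of "g * h"] by simp
  then have "F dvd Polynomial.smult c (g * h - [:poly_norm F g:])" by (rule dvd_smult)
  moreover have "Polynomial.smult c (g * h - [:poly_norm F g:]) = g * Polynomial.smult c h - 1"
    using c by (simp add: smult_diff_right mult.commute one_pCons)
  ultimately show ?thesis by metis
qed

lemma inverse_mod_imp_poly_norm_unit:
  assumes F: "Polynomial.lead_coeff F = 1" and "F dvd g * h - 1"
  shows "poly_norm F g dvd 1"
  using poly_norm_cong[OF F assms(2)] by (metis F dvd_triv_left poly_norm_1 poly_norm_mult)

section \<open>The norm modulo a product of linear factors\<close>

lemma monic_linear_mult: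
  fixes F :: "'a::comm_ring_1 poly"
  assumes F: "Polynomial.lead_coeff F = 1"
  shows "Polynomial.degree ([:- r, 1:] * F) = Suc (Polynomial.degree F)"
    and "Polynomial.lead_coeff ([:- r, 1:] * F) = 1"
proof -
  have c: "Polynomial.coeff ([:- r, 1:] * F) (Suc (Polynomial.degree F)) = 1"
    using F by (simp add: coeff_eq_0)
  then have "Suc (Polynomial.degree F) \<le> Polynomial.degree ([:- r, 1:] * F)"
    by (intro le_degree) simp
  moreover have "Polynomial.degree ([:- r, 1:] * F) \<le> Suc (Polynomial.degree F)"
    by (rule order_trans[OF degree_mult_le]) simp
  ultimately show "Polynomial.degree ([:- r, 1:] * F) = Suc (Polynomial.degree F)" by simp
  with c show "Polynomial.lead_coeff ([:- r, 1:] * F) = 1" by simp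
qed

text \<open>In the basis \<open>1, (x - r), (x - r) x, \<dots>\<close> of the quotient by \<open>(x - r) F\<close>, multiplication
  by \<open>g\<close> is block triangular with diagonal blocks \<open>g(r)\<close> and multiplication by \<open>g\<close> modulo \<open>F\<close>.\<close>
lemma poly_norm_linear_mult:
  fixes F :: "'a::comm_ring_1 poly"
  assumes F: "Polynomial.lead_coeff F = 1"
  shows "poly_norm ([:- r, 1:] * F) g = Polynomial.poly g r * poly_norm F g"
proof -
  define m where "m = Polynomial.degree F"
  define G where "G = [:- r, 1:] * F"
  have degG: "Polynomial.degree G = Suc m" and G: "Polynomial.lead_coeff G = 1"
    using monic_linear_mult[OF F] by (simp_all add: G_def m_def)
  define b where "b j = (case j of 0 \<Rightarrow> 1 | Suc k \<Rightarrow> [:- r, 1:] * Polynomial.monom 1 k)" for j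
  define B where "B = mat (Suc m) (Suc m) (\<lambda>(i, j). Polynomial.coeff (b j) i)"
  \<comment> \<open>Since g = g(r) + (x - r) \<open>synthetic_div g r\<close>, this is (g - g(r)) /
    (x - r) reduced modulo \<open>F\<close>; it fills the first column of the block matrix below the
    diagonal.\<close>
  define q where "q = monic_mod F (synthetic_div g r)"
  define M where "M = four_block_mat (mat 1 1 (\<lambda>_. Polynomial.poly g r)) (0\<^sub>m 1 m)
    (mat m 1 (\<lambda>(i, _). Polynomial.coeff q i)) (mult_mat F g)"
  have coeff_b_Suc: "Polynomial.coeff (b (Suc k)) i = (if i = Suc k then 1 else 0) - r * (if i = k then 1 else 0)" for i k
    by (auto simp: b_def coeff_pCons split: nat.splits)
  have b_small: "Polynomial.coeff (b j) i = 0" if "Suc m \<le> i" "j < Suc m" for i j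
    using that by (cases j) (simp_all add: coeff_b_Suc, simp add: b_def)
  \<comment> \<open>Multiplication by x - r maps remainders modulo \<open>F\<close> to remainders
    modulo \<open>G\<close>: both degree bounds rise by one.\<close>
  have mod_lin: "monic_mod G ([:- r, 1:] * p) = [:- r, 1:] * monic_mod F p" for p
  proof -
    obtain s where s: "p = F * s + monic_mod F p" using monic_mod_decomp[OF F] .
    have "[:- r, 1:] * p = G * s + [:- r, 1:] * monic_mod F p"
      by (subst s) (simp only: G_def algebra_simps)
    then show ?thesis
      by (rule monic_mod_unique[OF G])
        (auto simp: degG coeff_pCons coeff_monic_mod_eq_0[OF F] m_def split: nat.split)
  qed
  have M: "M \<in> carrier_mat (Suc m) (Suc m)"
    using four_block_carrier_mat[of "mat 1 1 (\<lambda>_. Polynomial.poly g r)" 1 1 "mult_mat F g" m m]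
    by (simp add: M_def m_def)
  have B: "B \<in> carrier_mat (Suc m) (Suc m)" by (simp add: B_def)
  have comb: "[:- r, 1:] * p = (\<Sum>k<m. Polynomial.smult (Polynomial.coeff p k) (b (Suc k)))"
    if "\<And>i. m \<le> i \<Longrightarrow> Polynomial.coeff p i = 0" for p
    using arg_cong[OF poly_eq_sum_monom_lessThan[OF that], where f = "\<lambda>p. [:- r, 1:] * p"]
    by (simp only: sum_distrib_left mult_smult_right b_def nat.case)
  \<comment> \<open>Both \<open>mult_mat G g * B\<close> and \<open>B * M\<close> have the
    coefficient vectors of \<open>g * b j\<close> modulo \<open>G\<close> as columns: the former by
    definition of the multiplication matrix, the latter by expansion in the basis \<open>b\<close>.
    As \<open>det B = 1\<close>, the determinants of \<open>mult_mat G g\<close> and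
    \<open>M\<close> agree.\<close>
  have "mult_mat G g * B = mat (Suc m) (Suc m) (\<lambda>(i, j). Polynomial.coeff (monic_mod G (g * b j)) i)"
    unfolding B_def by (rule mult_mat_times_cols[OF G]) (simp_all add: degG b_small)
  also have "\<dots> = B * M"
  proof (rule eq_matI)
    fix i j assume "i < dim_row (B * M)" "j < dim_col (B * M)"
    then have ij: "i < Suc m" "j < Suc m" using B M by auto
    have "Polynomial.coeff (monic_mod G (g * b j)) i = (\<Sum>k<Suc m. Polynomial.coeff (b k) i * M $$ (k, j))"
    proof (cases j)
      case 0
      have "g = [:- r, 1:] * synthetic_div g r + [:Polynomial.poly g r:]"
        using synthetic_div_correct'[of r g] by (simp only:)
      then have "monic_mod G g = [:- r, 1:] * q + [:Polynomial.poly g r:]"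
        by (metis (no_types, lifting) G coeff_pCons_Suc degG le_Suc_ex add_Suc mod_lin monic_mod_add monic_mod_small coeff_0 q_def)
      also have "[:- r, 1:] * q = (\<Sum>k<m. Polynomial.smult (Polynomial.coeff q k) (b (Suc k)))"
        by (rule comb) (simp add: q_def m_def coeff_monic_mod_eq_0[OF F])
      finally have "monic_mod G (g * b j) = (\<Sum>k<m. Polynomial.smult (Polynomial.coeff q k) (b (Suc k))) + Polynomial.smult (Polynomial.poly g r) (b 0)"
        by (simp add: 0 b_def)
      moreover have "M $$ (0, 0) = Polynomial.poly g r" "\<And>k. k < m \<Longrightarrow> M $$ (Suc k, 0) = Polynomial.coeff q k"
        by (simp_all add: M_def m_def[symmetric] mult_mat_def)
      ultimately show ?thesis
        by (simp add: 0 sum.lessThan_Suc_shift coeff_sum mult.commute add.commute del: sum.lessThan_Suc)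
    next
      case (Suc l)
      then have l: "l < m" using ij by simp
      have "g * b j = [:- r, 1:] * (g * Polynomial.monom 1 l)"
        by (simp only: Suc b_def nat.case mult.left_commute)
      then have "monic_mod G (g * b j) = [:- r, 1:] * monic_mod F (g * Polynomial.monom 1 l)"
        by (simp only: mod_lin)
      also have "\<dots> = (\<Sum>k<m. Polynomial.smult (Polynomial.coeff (monic_mod F (g * Polynomial.monom 1 l)) k) (b (Suc k)))"
        by (rule comb) (simp add: q_def m_def coeff_monic_mod_eq_0[OF F])
      moreover have "M $$ (0, Suc l) = 0"
        "\<And>k. k < m \<Longrightarrow> M $$ (Suc k, Suc l) = Polynomial.coeff (monic_mod F (g * Polynomial.monom 1 l)) k"
        using l by (simp_all add: M_def m_def[symmetric] mult_mat_def)
      ultimately show ?thesis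
        by (simp add: Suc sum.lessThan_Suc_shift coeff_sum mult.commute del: sum.lessThan_Suc)
    qed
    also have "\<dots> = (B * M) $$ (i, j)"
      using ij B M by (simp add: scalar_prod_def lessThan_atLeast0 del: sum.op_ivl_Suc) (simp add: B_def)
    finally show "mat (Suc m) (Suc m) (\<lambda>(i, j). Polynomial.coeff (monic_mod G (g * b j)) i) $$ (i, j) = (B * M) $$ (i, j)"
      using ij by simp
  qed (use B M in auto)
  finally have "det (mult_mat G g) * det B = det B * det M"
    using det_mult[OF _ B, of "mult_mat G g"] det_mult[OF B M] mult_mat_carrier[of G g]
    by (simp add: degG)
  moreover have "det B = 1"
  proof -
    \<comment> \<open>Column \<open>Suc k\<close> holds x^(k+1) - r x^k, and column 0 holds 1, so
      \<open>B\<close> is upper unitriangular.\<close>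
    have "upper_triangular B"
    proof (rule upper_triangularI)
      fix i j assume "j < i" "i < dim_row B"
      then show "B $$ (i, j) = 0"
        by (cases j) (simp_all add: B_def coeff_b_Suc, simp add: b_def)
    qed
    moreover have "diag_mat B = replicate (Suc m) 1"
    proof (rule nth_equalityI)
      fix i assume "i < length (diag_mat B)"
      then show "diag_mat B ! i = replicate (Suc m) 1 ! i"
        by (cases i) (auto simp: diag_mat_def B_def coeff_b_Suc simp del: upt_Suc replicate.simps, simp_all add: b_def)
    qed (simp add: diag_mat_def B_def)
    ultimately show ?thesis using det_upper_triangular[OF _ B] by simp
  qed
  moreover have "det M = Polynomial.poly g r * poly_norm F g"
  proof -
    \<comment> \<open>\<open>M\<close> is block lower triangular; transposing moves the zero block
      to the lower left corner, where the determinant is known to factor over the diagonal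
      blocks.\<close>
    have "transpose_mat M = four_block_mat (mat 1 1 (\<lambda>_. Polynomial.poly g r))
      (transpose_mat (mat m 1 (\<lambda>(i, _). Polynomial.coeff q i))) (0\<^sub>m m 1) (transpose_mat (mult_mat F g))"
      unfolding M_def
      by (subst transpose_four_block_mat[of _ 1 1 _ m _ m])
        (auto simp: m_def intro!: arg_cong2[where f = "\<lambda>x y. four_block_mat x _ y _"])
    then have "det M = det (four_block_mat (mat 1 1 (\<lambda>_. Polynomial.poly g r))
      (transpose_mat (mat m 1 (\<lambda>(i, _). Polynomial.coeff q i))) (0\<^sub>m m 1) (transpose_mat (mult_mat F g)))"
      using det_transpose[OF M] by simp
    also have "\<dots> = det (mat 1 1 (\<lambda>_. Polynomial.poly g r)) * det (transpose_mat (mult_mat F g))"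
      by (rule det_four_block_mat_lower_left_zero_col) (auto simp: m_def)
    also have "\<dots> = Polynomial.poly g r * poly_norm F g"
      by (simp add: poly_norm_def det_transpose[OF mult_mat_carrier] det_single)
    finally show ?thesis .
  qed
  ultimately show ?thesis by (simp add: poly_norm_def G_def)
qed

lemma monic_prod_linear:
  fixes r :: "'i \<Rightarrow> 'a::comm_ring_1"
  assumes "finite I"
  shows "Polynomial.lead_coeff (\<Prod>i\<in>I. [:- r i, 1:]) = 1 \<and>
    Polynomial.degree (\<Prod>i\<in>I. [:- r i, 1:]) = card I"
  using assms
proof (induction I)
  case (insert i I)
  then show ?case
    using monic_linear_mult[of "\<Prod>i\<in>I. [:- r i, 1:]" "r i"] by (auto simp del: mult_pCons_left)
qed simp

lemma poly_norm_prod_linear: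
  fixes r :: "'i \<Rightarrow> 'a::comm_ring_1"
  assumes "finite I"
  shows "poly_norm (\<Prod>i\<in>I. [:- r i, 1:]) g = (\<Prod>i\<in>I. Polynomial.poly g (r i))"
  using assms
proof (induction I)
  case empty
  then show ?case by (simp add: poly_norm_def mult_mat_def)
next
  case (insert i I)
  then show ?case
    using poly_norm_linear_mult[of "\<Prod>i\<in>I. [:- r i, 1:]" "r i" g] monic_prod_linear[OF insert.hyps(1), of r]
    by (auto simp del: mult_pCons_left)
qed
section \<open>Elementary symmetric polynomials\<close>


definition mono_val :: "(nat \<Rightarrow> 'b::comm_ring_1) \<Rightarrow> (nat \<Rightarrow>\<^sub>0 nat) \<Rightarrow> 'b" where
  "mono_val x m = (\<Prod>i\<in>Poly_Mapping.keys m. x i ^ Poly_Mapping.lookup m i)"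

lemma mono_val_superset:
  assumes "finite S" "Poly_Mapping.keys m \<subseteq> S"
  shows "mono_val x m = (\<Prod>i\<in>S. x i ^ Poly_Mapping.lookup m i)"
  unfolding mono_val_def
  by (rule prod.mono_neutral_left) (use assms in \<open>auto simp: in_keys_iff\<close>)

lemma mono_val_0: "mono_val x 0 = 1"
  by (simp add: mono_val_def)

lemma mono_val_add: "mono_val x (m + m') = mono_val x m * mono_val x m'"
proof -
  let ?S = "Poly_Mapping.keys m \<union> Poly_Mapping.keys m'"
  have "Poly_Mapping.keys (m + m') \<subseteq> ?S" by (rule Poly_Mapping.keys_add)
  then show ?thesis
    by (simp add: mono_val_superset[of ?S] lookup_add power_add prod.distrib)
qed

lemma mpsubst_mono_val:
  "mpsubst h x Q = (\<Sum>m\<in>Poly_Mapping.keys Q. h (Poly_Mapping.lookup Q m) * mono_val x m)"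
  by (simp add: mpsubst_def mono_val_def)

lemma poly_mapping_eq_sum_single:
  fixes Q :: "'b \<Rightarrow>\<^sub>0 'a::comm_monoid_add"
  shows "Q = (\<Sum>m\<in>Poly_Mapping.keys Q. Poly_Mapping.single m (Poly_Mapping.lookup Q m))"
  by (rule poly_mapping_eqI)
    (auto simp: lookup_sum lookup_single when_def in_keys_iff)

text \<open>For products, both factors are written as sums of single monomials, on which
  \<open>mono_val\<close> turns addition of exponents into multiplication.\<close>

lemma comm_ring_hom_mpsubst:
  assumes "comm_ring_hom h"
  shows "comm_ring_hom (mpsubst h x)"
proof -
  interpret h: comm_ring_hom h by fact
  have add: "mpsubst h x (P + Q) = mpsubst h x P + mpsubst h x Q" for P Q
    unfolding mpsubst_mono_val
    by (rule setsum_keys_plus_distrib[of "\<lambda>m c. h c * mono_val x m"])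
      (auto simp: h.hom_add distrib_right)
  have zero: "mpsubst h x 0 = 0" by (simp add: mpsubst_def)
  have sum: "mpsubst h x (\<Sum>i\<in>I. f i) = (\<Sum>i\<in>I. mpsubst h x (f i))" for I and f :: "'i \<Rightarrow> _"
    by (induction I rule: infinite_finite_induct) (auto simp: add zero)
  have single: "mpsubst h x (Poly_Mapping.single m c) = h c * mono_val x m" for m c
    by (simp add: mpsubst_mono_val)
  have one: "mpsubst h x 1 = 1"
    using single[of 0 1] by (simp add: mono_val_0)
  have mult: "mpsubst h x (P * Q) = mpsubst h x P * mpsubst h x Q" for P Q
  proof -
    have "P * Q = (\<Sum>m\<in>Poly_Mapping.keys P. Poly_Mapping.single m (Poly_Mapping.lookup P m))
      * (\<Sum>m\<in>Poly_Mapping.keys Q. Poly_Mapping.single m (Poly_Mapping.lookup Q m))"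
      by (simp flip: poly_mapping_eq_sum_single)
    also have "\<dots> = (\<Sum>m\<in>Poly_Mapping.keys P. \<Sum>m'\<in>Poly_Mapping.keys Q.
      Poly_Mapping.single (m + m') (Poly_Mapping.lookup P m * Poly_Mapping.lookup Q m'))"
      by (simp add: sum_product mult_single)
    finally have "mpsubst h x (P * Q) = (\<Sum>m\<in>Poly_Mapping.keys P. \<Sum>m'\<in>Poly_Mapping.keys Q.
      (h (Poly_Mapping.lookup P m) * mono_val x m) * (h (Poly_Mapping.lookup Q m') * mono_val x m'))"
      by (simp add: sum single h.hom_mult mono_val_add mult_ac)
    then show ?thesis by (simp add: mpsubst_mono_val sum_product)
  qed
  show ?thesis
    by unfold_locales (simp_all add: add zero one mult)
qed

lemma comm_ring_hom_mpconst: "comm_ring_hom mpconst"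
  by unfold_locales (simp_all add: mpconst_def single_add mult_single)

lemma mpsubst_mpconst:
  assumes "h 0 = 0"
  shows "mpsubst h x (mpconst c) = h c"
  using assms by (cases "c = 0") (simp_all add: mpsubst_def mpconst_def)

lemma mpsubst_mpvar:
  assumes "h 1 = 1"
  shows "mpsubst h x (mpvar j) = x j"
  using assms by (simp add: mpsubst_def mpvar_def)

section \<open>Monic polynomials with signed coefficients, and Vieta's formulas\<close>

definition monic_of :: "nat \<Rightarrow> (nat \<Rightarrow> 'a::comm_ring_1) \<Rightarrow> 'a poly" where
  "monic_of n u = Polynomial.monom 1 n + (\<Sum>i\<in>{1..n}. Polynomial.monom ((-1) ^ i * u i) (n - i))"

lemma coeff_monic_of:
  "Polynomial.coeff (monic_of n u) k =
    (if k = n then 1 else if k < n then (-1) ^ (n - k) * u (n - k) else 0)"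
proof -
  have "(\<Sum>i\<in>{1..n}. Polynomial.coeff (Polynomial.monom ((-1) ^ i * u i) (n - i)) k)
    = (\<Sum>i\<in>{1..n}. if i = n - k \<and> k < n then (-1) ^ i * u i else 0)"
    by (rule sum.cong) auto
  also have "\<dots> = (if k < n then (-1) ^ (n - k) * u (n - k) else 0)"
    by (cases "k < n") auto
  finally show ?thesis by (auto simp: monic_of_def coeff_sum)
qed

lemma monic_of_monic:
  fixes u :: "nat \<Rightarrow> 'a::comm_ring_1"
  shows "Polynomial.degree (monic_of n u) = n" and "Polynomial.lead_coeff (monic_of n u) = 1"
proof -
  show "Polynomial.degree (monic_of n u) = n"
    by (rule antisym[OF degree_le le_degree]) (auto simp: coeff_monic_of)
  then show "Polynomial.lead_coeff (monic_of n u) = 1" by (simp add: coeff_monic_of)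
qed

lemma monic_of_uF:
  assumes "Polynomial.lead_coeff F = 1" "Polynomial.degree F = n"
  shows "monic_of n (uF F n) = F"
proof (rule poly_eqI)
  fix k
  have "(-1) ^ j * ((-1) ^ j * c) = (c :: 'a)" for j c
    by (simp flip: mult.assoc power_mult_distrib)
  then show "Polynomial.coeff (monic_of n (uF F n)) k = Polynomial.coeff F k"
    using assms by (auto simp: coeff_monic_of uF_def intro: coeff_eq_0)
qed

lemma (in comm_ring_hom) map_poly_monic_of:
  "map_poly hom (monic_of n u) = monic_of n (\<lambda>i. hom (u i))"
  by (rule poly_eqI) (simp add: coeff_monic_of hom_mult hom_power hom_uminus)

lemma monic_of_cong:
  assumes "\<And>i. i \<in> {1..n} \<Longrightarrow> u i = v i"
  shows "monic_of n u = monic_of n v"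
  using assms by (simp add: monic_of_def)

text \<open>Vieta's formulas: expanding the product means choosing a subset of the factors that
  contribute their constant term while the others contribute the variable. Grouping the subsets by
  cardinality collects the elementary symmetric functions.\<close>

lemma prod_linear_eq_monic_of_esym:
  fixes x :: "nat \<Rightarrow> 'a::comm_ring_1"
  shows "(\<Prod>i\<in>{1..n}. [:- x i, 1:]) = monic_of n (\<lambda>i. esym n i x)"
proof -
  let ?X = "Polynomial.monom 1 1 :: 'a poly"
  let ?P = "\<lambda>S. Polynomial.monom ((-1) ^ card S * (\<Prod>i\<in>S. x i)) (n - card S)"
  have lin: "[:- a, 1:] = [:- a:] + ?X" for a :: 'a
    by (simp add: monom_altdef)
  have const: "(\<Prod>i\<in>S. [:- x i:]) = [:(-1) ^ card S * (\<Prod>i\<in>S. x i):]" if "finite S" for S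
    using that by induction (auto simp: one_pCons)
  have "(\<Prod>i\<in>{1..n}. [:- x i, 1:]) = (\<Sum>S\<in>Pow {1..n}. (\<Prod>i\<in>S. [:- x i:]) * (\<Prod>i\<in>{1..n} - S. ?X))"
    unfolding lin by (rule prod_add) simp
  also have "\<dots> = (\<Sum>S\<in>Pow {1..n}. ?P S)"
  proof (rule sum.cong[OF refl])
    fix S assume S: "S \<in> Pow {1..n}"
    then have "finite S" by (auto intro: finite_subset)
    then show "(\<Prod>i\<in>S. [:- x i:]) * (\<Prod>i\<in>{1..n} - S. ?X) = ?P S"
      using S by (simp add: const card_Diff_subset monom_power smult_monom)
  qed
  also have "\<dots> = (\<Sum>j\<in>{0..n}. \<Sum>S\<in>{S \<in> Pow {1..n}. card S = j}. ?P S)"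
    by (rule sum.group[symmetric]) (auto dest!: card_mono[rotated])
  also have "\<dots> = (\<Sum>j\<in>{0..n}. Polynomial.monom ((-1) ^ j * esym n j x) (n - j))"
    by (rule sum.cong)
      (auto simp: esym_def sum_distrib_left monom_hom.hom_sum intro!: sum.cong)
  also have "\<dots> = Polynomial.monom (esym n 0 x) n + (\<Sum>j\<in>{1..n}. Polynomial.monom ((-1) ^ j * esym n j x) (n - j))"
    by (simp add: sum.atLeast_Suc_atMost)
  also have "esym n 0 x = 1"
  proof -
    have "{S. S \<subseteq> {1..n} \<and> card S = 0} = {{}}" by (auto dest: finite_subset)
    then show ?thesis by (simp add: esym_def)
  qed
  finally show ?thesis by (simp add: monic_of_def)
qed

section \<open>Leading monomials and algebraic independence of the elementary symmetric
  polynomials\<close>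

text \<open>For exponent vectors the order is lexicographic, decided by the smallest index at which
  they differ. Demanding leading coefficient 1 makes leading monomials multiplicative even if the
  coefficient ring has zero divisors.\<close>

definition lead_monic :: "('b::{ordered_cancel_comm_monoid_add,linorder} \<Rightarrow>\<^sub>0 'a::comm_ring_1) \<Rightarrow> 'b \<Rightarrow> bool" where
  "lead_monic p e \<longleftrightarrow> Poly_Mapping.lookup p e = 1 \<and> (\<forall>k>e. Poly_Mapping.lookup p k = 0)"

lemma lead_monic_iff_keys:
  "lead_monic p e \<longleftrightarrow> (\<forall>k\<in>Poly_Mapping.keys (p - Poly_Mapping.single e 1). k < e)"
proof -
  have "k \<in> Poly_Mapping.keys (p - Poly_Mapping.single e 1) \<longleftrightarrow>
    (if k = e then Poly_Mapping.lookup p e \<noteq> 1 else Poly_Mapping.lookup p k \<noteq> 0)" for k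
    by (simp add: in_keys_iff lookup_minus lookup_single when_def)
  then show ?thesis
    unfolding lead_monic_def by (metis less_irrefl less_asym neqE)
qed

lemma lead_monic_1: "lead_monic 1 0"
  by (simp add: lead_monic_def lookup_one)

lemma lead_monic_mult:
  assumes p: "lead_monic p e" and q: "lead_monic q f"
  shows "lead_monic (p * q) (e + f)"
proof -
  define p' q' where "p' = p - Poly_Mapping.single e 1" and "q' = q - Poly_Mapping.single f 1"
  have less: "k < e" if "k \<in> Poly_Mapping.keys p'" for k
    using p that by (auto simp: lead_monic_iff_keys p'_def)
  have less': "k < f" if "k \<in> Poly_Mapping.keys q'" for k
    using q that by (auto simp: lead_monic_iff_keys q'_def)
  have sub: "Poly_Mapping.keys (a * b) \<subseteq> {k. k < e + f}"
    if le: "\<And>k. k \<in> Poly_Mapping.keys a \<Longrightarrow> k \<le> e" "\<And>k. k \<in> Poly_Mapping.keys b \<Longrightarrow> k \<le> f"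
      and lt: "(\<forall>k\<in>Poly_Mapping.keys a. k < e) \<or> (\<forall>k\<in>Poly_Mapping.keys b. k < f)"
    for a b :: "'a \<Rightarrow>\<^sub>0 'b"
  proof
    fix k assume "k \<in> Poly_Mapping.keys (a * b)"
    then obtain i j where "k = i + j" "i \<in> Poly_Mapping.keys a" "j \<in> Poly_Mapping.keys b"
      using keys_mult[of a b] by blast
    then show "k \<in> {k. k < e + f}"
      using le lt by (auto intro: add_less_le_mono add_le_less_mono)
  qed
  \<comment> \<open>The product of the leading terms cancels; each of the three remaining products
    has a factor whose monomials all lie strictly below its bound.\<close>
  have "p * q - Poly_Mapping.single (e + f) 1 =
    Poly_Mapping.single e 1 * q' + p' * Poly_Mapping.single f 1 + p' * q'"
    by (simp add: p'_def q'_def algebra_simps mult_single)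
  then have "Poly_Mapping.keys (p * q - Poly_Mapping.single (e + f) 1) \<subseteq>
    Poly_Mapping.keys (Poly_Mapping.single e 1 * q') \<union> Poly_Mapping.keys (p' * Poly_Mapping.single f 1)
      \<union> Poly_Mapping.keys (p' * q')"
    using Poly_Mapping.keys_add[of "Poly_Mapping.single e 1 * q' + p' * Poly_Mapping.single f 1" "p' * q'"]
      Poly_Mapping.keys_add[of "Poly_Mapping.single e 1 * q'" "p' * Poly_Mapping.single f 1"] by auto
  also have "\<dots> \<subseteq> {k. k < e + f}"
    by (intro Un_least sub) (auto simp: less_imp_le less less' split: if_splits)
  finally show ?thesis unfolding lead_monic_iff_keys by blast
qed

lemma lead_monic_prod:
  assumes "\<And>i. i \<in> I \<Longrightarrow> lead_monic (p i) (e i)"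
  shows "lead_monic (\<Prod>i\<in>I. p i) (\<Sum>i\<in>I. e i)"
  using assms by (induction I rule: infinite_finite_induct) (auto intro: lead_monic_1 lead_monic_mult)

lemma lead_monic_power:
  assumes "lead_monic p e"
  shows "lead_monic (p ^ k) (\<Sum>_<k. e)"
  using lead_monic_prod[of "{..<k}" "\<lambda>_. p" "\<lambda>_. e"] assms by simp

lemma prod_mpvar:
  "finite S \<Longrightarrow> (\<Prod>i\<in>S. mpvar i) = Poly_Mapping.single (\<Sum>i\<in>S. Poly_Mapping.single i 1) (1 :: 'a::comm_ring_1)"
  by (induction S rule: finite_induct) (simp_all add: mpvar_def mult_single)

lemma lookup_sum_single:
  "finite S \<Longrightarrow> Poly_Mapping.lookup (\<Sum>i\<in>S. Poly_Mapping.single i (1::nat)) k = (if k \<in> S then 1 else 0)"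
  by (simp add: lookup_sum lookup_single when_def)

text \<open>Among the products of \<open>j\<close> distinct variables, t_1 ... t_j is the
  lexicographically largest, and it occurs exactly once.\<close>

lemma lead_monic_esym:
  assumes j: "j \<in> {1..n}"
  shows "lead_monic (esym n j mpvar :: 'a::comm_ring_1 mpoly) (\<Sum>i\<in>{1..j}. Poly_Mapping.single i 1)"
proof -
  let ?e = "\<lambda>S. \<Sum>i\<in>S. Poly_Mapping.single i (1::nat)"
  let ?\<S> = "{S. S \<subseteq> {1..n} \<and> card S = j}"
  have fin: "finite S" if "S \<in> ?\<S>" for S using that by (auto intro: finite_subset)
  have less: "?e S < ?e {1..j}" if S: "S \<in> ?\<S>" "S \<noteq> {1..j}" for S
  proof -
    have "\<not> {1..j} \<subseteq> S" using S fin[OF S(1)] card_subset_eq[of S "{1..j}"] by auto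
    then have ex: "\<exists>k. k \<in> {1..j} - S" by auto
    \<comment> \<open>The first index of {1..j} missing from \<open>S\<close>: below
      \<open>k\<close> the two exponent vectors agree, and at \<open>k\<close> the vector of
      \<open>S\<close> has 0 against 1.\<close>
    define k where "k = (LEAST k. k \<in> {1..j} - S)"
    have k: "k \<in> {1..j} - S" unfolding k_def using ex by (rule LeastI_ex)
    have "k' \<in> S \<longleftrightarrow> k' \<in> {1..j}" if "k' < k" for k'
      using not_less_Least[of k' "\<lambda>k. k \<in> {1..j} - S"] that k S(1) unfolding k_def[symmetric] by auto
    then have "less_fun (Poly_Mapping.lookup (?e S)) (Poly_Mapping.lookup (?e {1..j}))"
      using k fin[OF S(1)] by (auto simp: less_fun_def lookup_sum_single simp del: One_nat_def intro!: exI[of _ k])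
    then show ?thesis by (simp add: less_poly_mapping.rep_eq)
  qed
  have lookup: "Poly_Mapping.lookup (esym n j mpvar :: 'a mpoly) k = (\<Sum>S\<in>?\<S>. if k = ?e S then 1 else 0)" for k
    unfolding esym_def lookup_sum
  proof (rule sum.cong[OF refl])
    fix S assume "S \<in> ?\<S>"
    show "Poly_Mapping.lookup (\<Prod>i\<in>S. mpvar i :: 'a mpoly) k = (if k = ?e S then 1 else 0)"
      unfolding prod_mpvar[OF fin[OF \<open>S \<in> ?\<S>\<close>]] lookup_single when_def
      by (rule if_cong[OF eq_commute refl refl])
  qed
  have finS: "finite ?\<S>" by simp
  have mem: "{1..j} \<in> ?\<S>" using j by auto
  have "Poly_Mapping.lookup (esym n j mpvar :: 'a mpoly) (?e {1..j}) = (\<Sum>S\<in>?\<S>. if S = {1..j} then 1 else 0)"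
    unfolding lookup
  proof (rule sum.cong[OF refl])
    fix S assume "S \<in> ?\<S>"
    then show "(if ?e {1..j} = ?e S then 1 else 0) = (if S = {1..j} then 1 else 0 :: 'a)"
      using less[of S] by (metis less_irrefl)
  qed
  also have "\<dots> = 1" using mem finS by simp
  finally have "Poly_Mapping.lookup (esym n j mpvar :: 'a mpoly) (?e {1..j}) = 1" .
  moreover have "Poly_Mapping.lookup (esym n j mpvar :: 'a mpoly) k = 0" if "k > ?e {1..j}" for k
    unfolding lookup using less that by (intro sum.neutral) (metis (mono_tags, lifting) less_asym less_irrefl)
  ultimately show ?thesis by (simp add: lead_monic_def)
qed

text \<open>Gauss's argument: the products of powers of the s_j for distinct exponent vectors have
  distinct leading monomials, so the largest one occurring cannot be cancelled. All leading
  coefficients being 1, its coefficient after substitution is a coefficient of \<open>Q\<close>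
  itself.\<close>

theorem esym_algebraically_independent:
  fixes Q :: "'a::comm_ring_1 mpoly"
  assumes keys: "\<forall>m\<in>Poly_Mapping.keys Q. Poly_Mapping.keys m \<subseteq> {1..n}"
    and eq: "mpsubst mpconst (\<lambda>j. esym n j mpvar) Q = 0"
  shows "Q = 0"
proof (rule ccontr)
  assume "Q \<noteq> 0"
  let ?K = "Poly_Mapping.keys Q"
  let ?s = "\<lambda>j. esym n j mpvar :: 'a mpoly"
  \<comment> \<open>The leading exponent of the product of the s_j^(m_j): every factor s_j
    contributes t_1 ... t_j.\<close>
  define ex where "ex m = (\<Sum>j\<in>{1..n}. \<Sum>_<Poly_Mapping.lookup m j. \<Sum>i\<in>{1..j}. Poly_Mapping.single i (1::nat))"
    for m :: "nat \<Rightarrow>\<^sub>0 nat"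
  have lead: "lead_monic (mono_val ?s m) (ex m)" if "m \<in> ?K" for m
  proof -
    have "mono_val ?s m = (\<Prod>j\<in>{1..n}. ?s j ^ Poly_Mapping.lookup m j)"
      using keys that by (intro mono_val_superset) auto
    then show ?thesis
      unfolding ex_def by (auto intro!: lead_monic_prod lead_monic_power lead_monic_esym simp del: sum_constant One_nat_def)
  qed
  have lookup_ex: "Poly_Mapping.lookup (ex m) i = (\<Sum>j\<in>{i..n}. Poly_Mapping.lookup m j)" if "1 \<le> i" for m i
  proof -
    have "Poly_Mapping.lookup (ex m) i = (\<Sum>j\<in>{1..n}. if i \<le> j then Poly_Mapping.lookup m j else 0)"
      unfolding ex_def lookup_sum[of _ "{1..n}"] lookup_sum[of _ "{..<_}"] lookup_sum_single[OF finite_atLeastAtMost]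
      using that by (intro sum.cong) auto
    also have "\<dots> = (\<Sum>j\<in>{i..n}. Poly_Mapping.lookup m j)"
      using that by (intro sum.mono_neutral_cong_right) auto
    finally show ?thesis .
  qed
  have inj: "m = m'" if m: "m \<in> ?K" "m' \<in> ?K" and "ex m = ex m'" for m m'
  proof (rule poly_mapping_eqI)
    fix i
    show "Poly_Mapping.lookup m i = Poly_Mapping.lookup m' i"
    proof (cases "i \<in> {1..n}")
      case True
      \<comment> \<open>The exponent of t_i is m_i + ... + m_n, so m_i is recovered as the
        difference of consecutive tail sums; for i = n the second sum is empty.\<close>
      have "Poly_Mapping.lookup (ex m) i = Poly_Mapping.lookup m i + Poly_Mapping.lookup (ex m) (Suc i)" for m
        using True by (simp add: lookup_ex sum.atLeast_Suc_atMost)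
      with \<open>ex m = ex m'\<close> show ?thesis by (metis add_right_cancel)
    next
      case False
      then have "i \<notin> Poly_Mapping.keys m" "i \<notin> Poly_Mapping.keys m'" using keys m by blast+
      then show ?thesis by (simp add: in_keys_iff)
    qed
  qed
  have "ex ` ?K \<noteq> {}" using \<open>Q \<noteq> 0\<close> by simp
  then have "Max (ex ` ?K) \<in> ex ` ?K" by (intro Max_in) auto
  then obtain m0 where m0: "m0 \<in> ?K" "ex m0 = Max (ex ` ?K)" by auto
  have lookup_const: "Poly_Mapping.lookup (mpconst c * p) k = c * Poly_Mapping.lookup p k" for c :: 'a and p k
    unfolding mpconst_def mult_map_scale_conv_mult[symmetric] by (simp add: Poly_Mapping.map.rep_eq when_def)
  have "0 = Poly_Mapping.lookup (\<Sum>m\<in>?K. mpconst (Poly_Mapping.lookup Q m) * mono_val ?s m) (ex m0)"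
    using eq by (simp add: mpsubst_mono_val)
  also have "\<dots> = (\<Sum>m\<in>?K. Poly_Mapping.lookup Q m * Poly_Mapping.lookup (mono_val ?s m) (ex m0))"
    by (simp add: lookup_sum lookup_const)
  also have "\<dots> = (\<Sum>m\<in>?K. if m = m0 then Poly_Mapping.lookup Q m0 else 0)"
  proof (rule sum.cong[OF refl])
    fix m assume m: "m \<in> ?K"
    then have "ex m \<le> ex m0" using m0 by simp
    then have "m = m0 \<or> ex m < ex m0" using inj[OF m m0(1)] by (auto simp: order.order_iff_strict)
    then show "Poly_Mapping.lookup Q m * Poly_Mapping.lookup (mono_val ?s m) (ex m0)
      = (if m = m0 then Poly_Mapping.lookup Q m0 else 0)"
      using lead[OF m] by (auto simp: lead_monic_def)
  qed
  also have "\<dots> = Poly_Mapping.lookup Q m0" using m0(1) by simp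
  finally show False using m0(1) by (simp add: in_keys_iff)
qed

section \<open>The universal norm\<close>

text \<open>Polynomials in the variables from \<open>J\<close> form a subring with all constants,
  and the substituted values lie in it. This controls which variables occur in a determinant without
  expanding it: it suffices that setting the other variables to 0 leaves it fixed.\<close>

lemma keys_mpsubst_restricted_vars:
  assumes "m \<in> Poly_Mapping.keys (mpsubst mpconst (\<lambda>j. if j \<in> J then mpvar j else 0) (Q :: 'a::comm_ring_1 mpoly))"
  shows "Poly_Mapping.keys m \<subseteq> J"
proof -
  define V where "V = {P :: 'a mpoly. \<forall>m\<in>Poly_Mapping.keys P. Poly_Mapping.keys m \<subseteq> J}"
  have add: "P + P' \<in> V" if "P \<in> V" "P' \<in> V" for P P'
    using that Poly_Mapping.keys_add[of P P'] by (auto simp: V_def subset_iff)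
  have mult: "P * P' \<in> V" if "P \<in> V" "P' \<in> V" for P P'
  proof -
    have "Poly_Mapping.keys (a + b) \<subseteq> J" if "a \<in> Poly_Mapping.keys P" "b \<in> Poly_Mapping.keys P'" for a b
      using that \<open>P \<in> V\<close> \<open>P' \<in> V\<close> Poly_Mapping.keys_add[of a b] by (auto simp: V_def subset_iff)
    then show ?thesis using keys_mult[of P P'] by (auto simp: V_def subset_iff)
  qed
  have one: "1 \<in> V" by (simp add: V_def)
  have zero: "0 \<in> V" by (simp add: V_def)
  have const: "mpconst c \<in> V" for c by (simp add: V_def mpconst_def)
  have var: "mpvar j \<in> V" if "j \<in> J" for j using that by (simp add: V_def mpvar_def)
  have pow: "P ^ k \<in> V" if "P \<in> V" for P k using that by (induction k) (auto intro: one mult)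
  have prod: "(\<Prod>i\<in>I. f i) \<in> V" if "\<And>i. i \<in> I \<Longrightarrow> f i \<in> V" for I and f :: "nat \<Rightarrow> _"
    using that by (induction I rule: infinite_finite_induct) (auto intro: one mult)
  have sum: "(\<Sum>i\<in>I. f i) \<in> V" if "\<And>i. i \<in> I \<Longrightarrow> f i \<in> V" for I and f :: "(nat \<Rightarrow>\<^sub>0 nat) \<Rightarrow> _"
    using that by (induction I rule: infinite_finite_induct) (auto intro: zero add)
  have "mpsubst mpconst (\<lambda>j. if j \<in> J then mpvar j else 0) Q \<in> V"
    unfolding mpsubst_def by (intro sum mult const prod pow) (auto intro: var zero)
  with assms show ?thesis by (auto simp: V_def)
qed

text \<open>The substitution is a ring homomorphism that carries the generic monic polynomial
  \<open>monic_of n mpvar\<close> to \<open>monic_of n x\<close>, and norms commute with ring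
  homomorphisms. Suitable \<open>h\<close> and \<open>x\<close> give the symmetric polynomial in the
  t_i as well as its value at the u_i.\<close>

lemma mpsubst_universal_norm:
  fixes h :: "'a::comm_ring_1 \<Rightarrow> 'b::comm_ring_1"
  assumes "comm_ring_hom h"
  shows "mpsubst h x (poly_norm (monic_of n mpvar) (map_poly mpconst G)) =
    poly_norm (monic_of n x) (map_poly h G)"
proof -
  interpret h: comm_ring_hom h by fact
  interpret c: comm_ring_hom "mpconst :: 'a \<Rightarrow> 'a mpoly" by (rule comm_ring_hom_mpconst)
  interpret s: comm_ring_hom "mpsubst h x" by (rule comm_ring_hom_mpsubst[OF assms])
  have "map_poly (mpsubst h x) (map_poly mpconst G) = map_poly h G"
    by (rule poly_eqI) (simp add: mpsubst_mpconst)
  then show ?thesis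
    by (simp add: s.poly_norm_map_poly[OF monic_of_monic(2), symmetric] s.map_poly_monic_of mpsubst_mpvar)
qed

text \<open>The universal norm, of \<open>G\<close> modulo the monic polynomial with indeterminate coefficients,
  is the polynomial in the elementary symmetric functions that represents \<open>G(t\<^sub>1) \<cdots> G(t\<^sub>n)\<close>.\<close>
theorem sF_eq_poly_norm:
  fixes F :: "'a::comm_ring_1 poly"
  assumes F: "Polynomial.lead_coeff F = 1" and n: "Polynomial.degree F = n"
  shows "sF n (uF F n) n G = poly_norm F G"
proof -
  define U :: "'a mpoly poly" where "U = monic_of n mpvar"
  define G' where "G' = map_poly mpconst G"
  define Q where "Q = poly_norm U G'"
  have subst: "mpsubst mpconst x Q = poly_norm (monic_of n x) G'" for x
    unfolding Q_def U_def G'_def by (rule mpsubst_universal_norm[OF comm_ring_hom_mpconst])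
  \<comment> \<open>\<open>monic_of n\<close> reads its argument only at the indices 1, ..., n, so
    setting all other variables to 0 does not change \<open>Q\<close>.\<close>
  have "mpsubst mpconst (\<lambda>j. if j \<in> {1..n} then mpvar j else 0) Q = Q"
    unfolding subst unfolding Q_def U_def
    by (intro arg_cong2[where f = poly_norm] monic_of_cong) auto
  then have keys: "\<forall>m\<in>Poly_Mapping.keys Q. Poly_Mapping.keys m \<subseteq> {1..n}"
    using keys_mpsubst_restricted_vars[of _ "{1..n}" Q] by simp
  have "{S. S \<subseteq> {1..n} \<and> card S = n} = {{1..n}}"
    by (auto dest: card_subset_eq[OF finite_atLeastAtMost])
  then have "symG n n G = (\<Prod>j\<in>{1..n}. Polynomial.poly G' (mpvar j))"
    by (simp add: symG_def esym_def G'_def)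
  \<comment> \<open>At the elementary symmetric functions of the t_i the generic polynomial splits
    into the factors x - t_i, so its norm is a product of values.\<close>
  also have "\<dots> = mpsubst mpconst (\<lambda>j. esym n j mpvar) Q"
    unfolding subst prod_linear_eq_monic_of_esym[symmetric]
    by (rule poly_norm_prod_linear[symmetric]) simp
  finally have sym: "mpsubst mpconst (\<lambda>j. esym n j mpvar) Q = symG n n G" ..
  have id: "comm_ring_hom (id :: 'a \<Rightarrow> 'a)" by unfold_locales auto
  have val: "mpsubst id (uF F n) Q = poly_norm F G"
    unfolding Q_def U_def G'_def mpsubst_universal_norm[OF id] monic_of_uF[OF F n] by simp
  show ?thesis
    unfolding sF_def
  proof (rule the_equality)
    show "\<exists>Q. (\<forall>m\<in>Poly_Mapping.keys Q. Poly_Mapping.keys m \<subseteq> {1..n}) \<and>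
      mpsubst mpconst (\<lambda>j. esym n j mpvar) Q = symG n n G \<and> poly_norm F G = mpsubst id (uF F n) Q"
      by (intro exI[of _ Q] conjI keys sym val[symmetric])
  next
    fix a
    assume "\<exists>Q. (\<forall>m\<in>Poly_Mapping.keys Q. Poly_Mapping.keys m \<subseteq> {1..n}) \<and>
      mpsubst mpconst (\<lambda>j. esym n j mpvar) Q = symG n n G \<and> a = mpsubst id (uF F n) Q"
    then obtain Q' where Q': "\<forall>m\<in>Poly_Mapping.keys Q'. Poly_Mapping.keys m \<subseteq> {1..n}"
      "mpsubst mpconst (\<lambda>j. esym n j mpvar) Q' = symG n n G" "a = mpsubst id (uF F n) Q'" by auto
    interpret s: comm_ring_hom "mpsubst mpconst (\<lambda>j. esym n j mpvar :: 'a mpoly)"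
      by (rule comm_ring_hom_mpsubst[OF comm_ring_hom_mpconst])
    have "Q' - Q = 0"
    proof (rule esym_algebraically_independent)
      show "\<forall>m\<in>Poly_Mapping.keys (Q' - Q). Poly_Mapping.keys m \<subseteq> {1..n}"
        using keys Q'(1) keys_diff[of Q' Q] by blast
    qed (simp add: s.hom_minus Q'(2) sym)
    with Q'(3) val show "a = poly_norm F G" by simp
  qed
qed
section \<open>Maximal ideals and the localized quotient\<close>


text \<open>Zorn's lemma for the ideals that contain \<open>a\<close> but not 1; the principal ideal
  of \<open>a\<close> is one of them because \<open>a\<close> is not a unit. A maximal member is a
  maximal ideal, since any larger proper ideal would again belong to the family.\<close>

lemma (in cring) exists_maximalideal_containing_nonunit:
  assumes a: "a \<in> carrier R" "a \<notin> Units R"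
  shows "\<exists>P. maximalideal P R \<and> a \<in> P"
proof -
  let ?A = "{I. ideal I R \<and> a \<in> I \<and> \<one> \<notin> I}"
  have "PIdl a \<in> ?A"
    using a cgenideal_ideal[OF a(1)] cgenideal_self[OF a(1)]
    by (auto simp: cgenideal_def Units_def m_comm)
  moreover have "\<Union>C \<in> ?A" if C: "C \<noteq> {}" "subset.chain ?A C" for C
  proof -
    have "subset.chain {I. ideal I R} C" using C(2) by (auto simp: subset.chain_def)
    from chain_Union_is_ideal[OF this] C show ?thesis by (auto simp: subset.chain_def)
  qed
  ultimately obtain P where P: "P \<in> ?A" "\<forall>I\<in>?A. P \<subseteq> I \<longrightarrow> I = P"
    using subset_Zorn_nonempty[of ?A] by blast
  have "maximalideal P R"
  proof (rule maximalidealI)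
    show "carrier R \<noteq> P" using P(1) by auto
    fix J assume J: "ideal J R" "P \<subseteq> J" "J \<subseteq> carrier R"
    show "J = P \<or> J = carrier R"
    proof (cases "\<one> \<in> J")
      case True
      then show ?thesis using ideal.one_imp_carrier[OF J(1)] by simp
    next
      case False
      then show ?thesis using P J by auto
    qed
  qed (use P in simp)
  with P(1) show ?thesis by auto
qed

lemma RA_simps [simp]:
  "carrier (RA :: 'a::comm_ring_1 ring) = UNIV" "x \<otimes>\<^bsub>RA\<^esub> y = x * y" "x \<oplus>\<^bsub>RA\<^esub> y = x + y"
  "\<one>\<^bsub>RA\<^esub> = 1" "\<zero>\<^bsub>RA\<^esub> = 0"
  by (simp_all add: ring_of_type_algebra_def)

lemma cring_RA: "cring (RA :: 'a::comm_ring_1 ring)"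
  by (rule cring_from_type_algebra)

lemma exists_maximalideal_RA:
  fixes a :: "'a::comm_ring_1"
  assumes "\<not> a dvd 1"
  shows "\<exists>P. maximalideal P RA \<and> a \<in> P"
proof (rule cring.exists_maximalideal_containing_nonunit[OF cring_RA])
  show "a \<notin> Units RA"
    using assms by (auto simp: Units_def dvd_def)
qed simp

section \<open>Congruences of determinants and polynomials modulo an ideal\<close>

text \<open>Stated with type-class operations, so that it covers ideals of \<open>RA\<close> and
  equally the kernel of a homomorphism from a type into a ring structure.\<close>

definition typed_ideal :: "'a::comm_ring_1 set \<Rightarrow> bool" where
  "typed_ideal P \<longleftrightarrow> 0 \<in> P \<and> (\<forall>a\<in>P. \<forall>b\<in>P. a + b \<in> P) \<and> (\<forall>a. \<forall>b\<in>P. a * b \<in> P)"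

lemma typed_ideal_if_ideal:
  fixes P :: "'a::comm_ring_1 set"
  assumes "ideal P RA"
  shows "typed_ideal P"
proof -
  interpret ideal P RA by fact
  show ?thesis
    using additive_subgroup.zero_closed[OF is_additive_subgroup]
      additive_subgroup.a_closed[OF is_additive_subgroup] I_l_closed
    by (simp add: typed_ideal_def)
qed

context
  fixes P :: "'a::comm_ring_1 set"
  assumes P: "typed_ideal P"
begin

lemma typed_ideal_closed:
  "0 \<in> P" "a \<in> P \<Longrightarrow> b \<in> P \<Longrightarrow> a + b \<in> P" "b \<in> P \<Longrightarrow> a * b \<in> P"
  "a \<in> P \<Longrightarrow> a * b \<in> P" "a \<in> P \<Longrightarrow> - a \<in> P" "a \<in> P \<Longrightarrow> b \<in> P \<Longrightarrow> a - b \<in> P"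
proof -
  show zero: "0 \<in> P" and add: "a \<in> P \<Longrightarrow> b \<in> P \<Longrightarrow> a + b \<in> P"
    and mult: "b \<in> P \<Longrightarrow> a * b \<in> P" for a b
    using P by (auto simp: typed_ideal_def)
  show "a \<in> P \<Longrightarrow> a * b \<in> P" using mult[of a b] by (simp add: mult.commute)
  show uminus: "a \<in> P \<Longrightarrow> - a \<in> P" for a using mult[of a "- 1"] by simp
  show "a \<in> P \<Longrightarrow> b \<in> P \<Longrightarrow> a - b \<in> P" using add[of a "- b"] uminus[of b] by simp
qed

lemma typed_ideal_sum: "(\<And>i. i \<in> I \<Longrightarrow> f i \<in> P) \<Longrightarrow> sum f I \<in> P"
  by (induction I rule: infinite_finite_induct) (auto intro: typed_ideal_closed)

lemma typed_ideal_prod_diff: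
  "(\<And>i. i \<in> I \<Longrightarrow> f i - g i \<in> P) \<Longrightarrow> prod f I - prod g I \<in> P"
proof (induction I rule: infinite_finite_induct)
  case (insert i I)
  have "prod f (insert i I) - prod g (insert i I) = f i * (prod f I - prod g I) + (f i - g i) * prod g I"
    using insert.hyps by (simp add: algebra_simps)
  also have "\<dots> \<in> P" using insert by (intro typed_ideal_closed(2)[OF typed_ideal_closed(3) typed_ideal_closed(4)]) auto
  finally show ?case .
qed (auto intro: typed_ideal_closed)

text \<open>By the Leibniz formula, entrywise congruent matrices have congruent determinants. This
  stands in for taking determinants over A/P.\<close>

lemma typed_ideal_det_diff:
  assumes A: "A \<in> carrier_mat n n" and B: "B \<in> carrier_mat n n"
    and diff: "\<And>i j. i < n \<Longrightarrow> j < n \<Longrightarrow> A $$ (i, j) - B $$ (i, j) \<in> P"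
  shows "det A - det B \<in> P"
proof -
  have "det A - det B = (\<Sum>p\<in>{p. p permutes {0..<n}}.
    signof p * ((\<Prod>i = 0..<n. A $$ (i, p i)) - (\<Prod>i = 0..<n. B $$ (i, p i))))"
    by (simp add: det_def'[OF A] det_def'[OF B] sum_subtractf right_diff_distrib)
  also have "\<dots> \<in> P"
  proof (intro typed_ideal_sum typed_ideal_closed(3) typed_ideal_prod_diff diff)
    fix p i assume "p \<in> {p. p permutes {0..<n}}" "i \<in> {0..<n}"
    then show "i < n" "p i < n" using permutes_in_image[of p "{0..<n}" i] by auto
  qed
  finally show ?thesis .
qed

text \<open>Membership in P[x], the kernel of the reduction A[x] -> (A/P)[x].\<close>

definition ideal_poly :: "'a poly \<Rightarrow> bool" where
  "ideal_poly p \<longleftrightarrow> (\<forall>i. Polynomial.coeff p i \<in> P)"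

lemma ideal_poly_closed:
  "ideal_poly 0" "ideal_poly p \<Longrightarrow> ideal_poly q \<Longrightarrow> ideal_poly (p + q)"
  "ideal_poly q \<Longrightarrow> ideal_poly (p * q)" "ideal_poly p \<Longrightarrow> ideal_poly (p * q)"
  "ideal_poly p \<Longrightarrow> ideal_poly q \<Longrightarrow> ideal_poly (p - q)" "ideal_poly p \<Longrightarrow> ideal_poly (- p)"
proof -
  show mult: "ideal_poly q \<Longrightarrow> ideal_poly (p * q)" for p q
    by (simp add: ideal_poly_def coeff_mult typed_ideal_sum typed_ideal_closed(3))
  show "ideal_poly p \<Longrightarrow> ideal_poly (p * q)" using mult[of p q] by (simp add: mult.commute)
qed (simp_all add: ideal_poly_def typed_ideal_closed)

text \<open>Taking remainders is A-linear, so the remainder of \<open>p\<close> combines the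
  remainders of the powers of x with the coefficients of \<open>p\<close>, which lie in
  \<open>P\<close>.\<close>

lemma ideal_poly_monic_mod:
  assumes F: "Polynomial.lead_coeff F = 1" and p: "ideal_poly p"
  shows "ideal_poly (monic_mod F p)"
proof -
  have "p = (\<Sum>j<Suc (Polynomial.degree p). Polynomial.smult (Polynomial.coeff p j) (Polynomial.monom 1 j))"
    by (rule poly_eq_sum_monom_lessThan) (simp add: coeff_eq_0)
  then have "monic_mod F p = (\<Sum>j<Suc (Polynomial.degree p).
    Polynomial.smult (Polynomial.coeff p j) (monic_mod F (Polynomial.monom 1 j)))"
    by (metis (no_types, lifting) F monic_mod_smult monic_mod_sum sum.cong)
  then show ?thesis
    using p by (auto simp: ideal_poly_def coeff_sum intro!: typed_ideal_closed typed_ideal_sum)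
qed

text \<open>If g h = 1 + s + F q with s in P[x], then N(g) N(h) = N(1 + s). This is congruent to
  N(1) = 1 modulo \<open>P\<close>, because the two multiplication matrices are congruent entrywise;
  N(g) in \<open>P\<close> would thus put 1 into \<open>P\<close>.\<close>

lemma poly_norm_notin_if_inverse_mod:
  assumes F: "Polynomial.lead_coeff F = 1" and P1: "1 \<notin> P"
    and s: "ideal_poly (g * h - 1 - F * q)"
  shows "poly_norm F g \<notin> P"
proof
  assume N: "poly_norm F g \<in> P"
  define s where "s = g * h - 1 - F * q"
  have "F dvd g * h - (1 + s)" by (simp add: s_def)
  then have "poly_norm F g * poly_norm F h = poly_norm F (1 + s)"
    by (metis F poly_norm_cong poly_norm_mult)
  then have "poly_norm F (1 + s) \<in> P" using N by (metis typed_ideal_closed(4))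
  moreover have "poly_norm F (1 + s) - poly_norm F 1 \<in> P"
    unfolding poly_norm_def
  proof (rule typed_ideal_det_diff[OF mult_mat_carrier mult_mat_carrier])
    fix i j assume ij: "i < Polynomial.degree F" "j < Polynomial.degree F"
    have "ideal_poly (monic_mod F (s * Polynomial.monom 1 j))"
      using s by (intro ideal_poly_monic_mod[OF F] ideal_poly_closed(4)) (simp add: s_def)
    then show "mult_mat F (1 + s) $$ (i, j) - mult_mat F 1 $$ (i, j) \<in> P"
      using ij by (simp add: mult_mat_def distrib_right monic_mod_add[OF F] ideal_poly_def)
  qed
  ultimately have "poly_norm F 1 \<in> P"
    using typed_ideal_closed(6)[of "poly_norm F (1 + s)" "poly_norm F (1 + s) - poly_norm F 1"] by simp
  then show False using P1 by (simp add: poly_norm_1[OF F])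
qed

end

lemma maximalideal_one_notin:
  fixes P :: "'a::comm_ring_1 set"
  assumes "maximalideal P RA"
  shows "1 \<notin> P"
proof -
  interpret maximalideal P RA by fact
  show ?thesis using one_imp_carrier I_notcarr by auto
qed

lemma maximalideal_typed_ideal:
  fixes P :: "'a::comm_ring_1 set"
  assumes "maximalideal P RA"
  shows "typed_ideal P"
  using assms by (intro typed_ideal_if_ideal) (rule maximalideal.axioms)

lemma inverse_mod_iff_maximal:
  fixes F :: "'a::comm_ring_1 poly"
  assumes F: "Polynomial.lead_coeff F = 1"
  shows "(\<exists>h. F dvd g * h - 1) \<longleftrightarrow>
    (\<forall>P. maximalideal P RA \<longrightarrow> (\<exists>h q. ideal_poly P (g * h - 1 - F * q)))"
proof (intro iffI allI impI)
  fix P :: "'a set"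
  assume "\<exists>h. F dvd g * h - 1" and P: "maximalideal P RA"
  then obtain h q where "g * h - 1 - F * q = 0" by (auto elim!: dvdE)
  then show "\<exists>h q. ideal_poly P (g * h - 1 - F * q)"
    using ideal_poly_closed(1)[OF maximalideal_typed_ideal[OF P]] by metis
next
  assume *: "\<forall>P. maximalideal P RA \<longrightarrow> (\<exists>h q. ideal_poly P (g * h - 1 - F * q))"
  show "\<exists>h. F dvd g * h - 1"
  proof (rule poly_norm_unit_imp_inverse_mod[OF F], rule ccontr)
    assume "\<not> poly_norm F g dvd 1"
    then obtain P where P: "maximalideal P RA" "poly_norm F g \<in> P"
      using exists_maximalideal_RA by blast
    with * obtain h q where "ideal_poly P (g * h - 1 - F * q)" by blast
    then show False
      using poly_norm_notin_if_inverse_mod[OF maximalideal_typed_ideal[OF P(1)] F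
        maximalideal_one_notin[OF P(1)]] P(2) by blast
  qed
qed

section \<open>The localized quotient over A\<close>

context
  fixes \<iota> :: "'k::field \<Rightarrow> 'a::comm_ring_1"
  assumes \<iota>: "comm_ring_hom \<iota>"
begin

lemma one_in_Sloc: "1 \<in> Sloc \<iota>"
proof -
  interpret comm_ring_hom \<iota> by (rule \<iota>)
  show ?thesis unfolding Sloc_def by (auto intro!: exI[of _ 1])
qed

lemma mult_in_Sloc: "s \<in> Sloc \<iota> \<Longrightarrow> t \<in> Sloc \<iota> \<Longrightarrow> s * t \<in> Sloc \<iota>"
proof -
  interpret comm_ring_hom \<iota> by (rule \<iota>)
  interpret mp: map_poly_comm_ring_hom \<iota> ..
  assume "s \<in> Sloc \<iota>" "t \<in> Sloc \<iota>"
  then obtain g h where "s = map_poly \<iota> g" "t = map_poly \<iota> h"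
    "Polynomial.poly g 0 \<noteq> 0" "Polynomial.poly h 0 \<noteq> 0"
    by (auto simp: Sloc_def)
  then show "s * t \<in> Sloc \<iota>"
    unfolding Sloc_def by (auto simp: mp.hom_mult intro!: exI[of _ "g * h"])
qed

lemma equiv_loc_rel: "equiv (UNIV \<times> Sloc \<iota>) (loc_rel \<iota> F)"
proof (rule equivI)
  show "loc_rel \<iota> F \<subseteq> (UNIV \<times> Sloc \<iota>) \<times> (UNIV \<times> Sloc \<iota>)" by (auto simp: loc_rel_def)
  show "refl_on (UNIV \<times> Sloc \<iota>) (loc_rel \<iota> F)"
    using one_in_Sloc by (auto simp: refl_on_def loc_rel_def)
  show "sym (loc_rel \<iota> F)"
  proof (rule symI)
    fix a b assume ab: "(a, b) \<in> loc_rel \<iota> F"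
    obtain p s q t where [simp]: "a = (p, s)" "b = (q, t)" by (cases a, cases b)
    have "F dvd w * (q * s - p * t) \<longleftrightarrow> F dvd w * (p * t - q * s)" for w
      using dvd_minus_iff[of F "w * (p * t - q * s)"] by (simp add: right_diff_distrib)
    with ab show "(b, a) \<in> loc_rel \<iota> F" by (simp add: loc_rel_def)
  qed
  show "trans (loc_rel \<iota> F)"
  proof (rule transI)
    fix a b c assume ab: "(a, b) \<in> loc_rel \<iota> F" and bc: "(b, c) \<in> loc_rel \<iota> F"
    obtain p s q t r v where [simp]: "a = (p, s)" "b = (q, t)" "c = (r, v)" by (cases a, cases b, cases c)
    from ab bc obtain w w' where S: "s \<in> Sloc \<iota>" "t \<in> Sloc \<iota>" "v \<in> Sloc \<iota>" "w \<in> Sloc \<iota>" "w' \<in> Sloc \<iota>"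
      and d: "F dvd w * (p * t - q * s)" "F dvd w' * (q * v - r * t)"
      by (auto simp: loc_rel_def)
    \<comment> \<open>Transitivity of equality of fractions: besides the two witnesses, the middle
      denominator \<open>t\<close> has to be absorbed into the new witness.\<close>
    have "w * w' * t * (p * v - r * s) = w' * v * (w * (p * t - q * s)) + w * s * (w' * (q * v - r * t))"
      by (simp add: algebra_simps)
    then have "F dvd w * w' * t * (p * v - r * s)" using d by (metis dvd_add dvd_mult)
    moreover have "w * w' * t \<in> Sloc \<iota>" using S by (intro mult_in_Sloc)
    ultimately show "(a, c) \<in> loc_rel \<iota> F" using S by (auto simp: loc_rel_def)
  qed
qed

lemma frac_class_eq_iff:
  assumes "s \<in> Sloc \<iota>" "t \<in> Sloc \<iota>"
  shows "frac_class \<iota> F p s = frac_class \<iota> F q t \<longleftrightarrow> (\<exists>w\<in>Sloc \<iota>. F dvd w * (p * t - q * s))"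
  by (subst eq_equiv_class_iff[OF equiv_loc_rel]) (use assms in \<open>auto simp: loc_rel_def\<close>)

lemma frac_class_in_LQ: "s \<in> Sloc \<iota> \<Longrightarrow> frac_class \<iota> F p s \<in> LQ \<iota> F"
  unfolding LQ_def by (rule quotientI) simp

lemma LQ_cases:
  assumes "Z \<in> LQ \<iota> F"
  obtains p s where "s \<in> Sloc \<iota>" "Z = frac_class \<iota> F p s"
  using assms unfolding LQ_def by (elim quotientE) auto

text \<open>Localizing changes nothing exactly when the denominators are already units modulo
  \<open>F\<close>. With s h = 1 one has p/s = p h, and the witnesses in the relation can be
  cancelled. Conversely, surjectivity writes 1/g as p/1, so p g and 1 have the same class, and
  injectivity brings this equation back to A[x]/(F).\<close>

lemma inverse_mod_iff_frac_map_iso: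
  "(\<forall>g. Polynomial.poly g 0 \<noteq> 0 \<longrightarrow> (\<exists>h. F dvd map_poly \<iota> g * h - 1)) \<longleftrightarrow>
   (\<forall>Z\<in>LQ \<iota> F. \<exists>p. Z = frac_class \<iota> F p 1) \<and>
   (\<forall>p q. frac_class \<iota> F p 1 = frac_class \<iota> F q 1 \<longleftrightarrow> F dvd p - q)"
proof
  assume *: "\<forall>g. Polynomial.poly g 0 \<noteq> 0 \<longrightarrow> (\<exists>h. F dvd map_poly \<iota> g * h - 1)"
  have inv: "\<exists>h. F dvd s * h - 1" if "s \<in> Sloc \<iota>" for s
    using * that by (auto simp: Sloc_def)
  show "(\<forall>Z\<in>LQ \<iota> F. \<exists>p. Z = frac_class \<iota> F p 1) \<and>
    (\<forall>p q. frac_class \<iota> F p 1 = frac_class \<iota> F q 1 \<longleftrightarrow> F dvd p - q)"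
  proof (intro conjI ballI allI)
    fix Z assume "Z \<in> LQ \<iota> F"
    then obtain p s where s: "s \<in> Sloc \<iota>" and Z: "Z = frac_class \<iota> F p s" by (rule LQ_cases)
    from inv[OF s] obtain h where "F dvd s * h - 1" ..
    then have "F dvd (- p) * (s * h - 1)" by (rule dvd_mult)
    also have "(- p) * (s * h - 1) = 1 * (p * 1 - p * h * s)" by (simp add: algebra_simps)
    finally show "\<exists>p. Z = frac_class \<iota> F p 1"
      using Z s one_in_Sloc by (subst Z) (auto simp only: frac_class_eq_iff intro!: exI[of _ "p * h"])
  next
    fix p q
    show "frac_class \<iota> F p 1 = frac_class \<iota> F q 1 \<longleftrightarrow> F dvd p - q"
      unfolding frac_class_eq_iff[OF one_in_Sloc one_in_Sloc]
    proof
      assume "\<exists>w\<in>Sloc \<iota>. F dvd w * (p * 1 - q * 1)"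
      then obtain w where w: "w \<in> Sloc \<iota>" "F dvd w * (p - q)" by auto
      from inv[OF w(1)] obtain h where h: "F dvd w * h - 1" ..
      have "p - q = h * (w * (p - q)) - (p - q) * (w * h - 1)" by (simp add: algebra_simps)
      then show "F dvd p - q" using w h by (metis dvd_diff dvd_mult)
    qed (use one_in_Sloc in \<open>auto intro!: bexI[of _ 1]\<close>)
  qed
next
  assume *: "(\<forall>Z\<in>LQ \<iota> F. \<exists>p. Z = frac_class \<iota> F p 1) \<and>
    (\<forall>p q. frac_class \<iota> F p 1 = frac_class \<iota> F q 1 \<longleftrightarrow> F dvd p - q)"
  show "\<forall>g. Polynomial.poly g 0 \<noteq> 0 \<longrightarrow> (\<exists>h. F dvd map_poly \<iota> g * h - 1)"
  proof (intro allI impI)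
    fix g :: "'k poly" assume "Polynomial.poly g 0 \<noteq> 0"
    then have g: "map_poly \<iota> g \<in> Sloc \<iota>" by (auto simp: Sloc_def)
    obtain p where "frac_class \<iota> F 1 (map_poly \<iota> g) = frac_class \<iota> F p 1"
      using bspec[OF conjunct1[OF *] frac_class_in_LQ[OF g]] ..
    then have "\<exists>w\<in>Sloc \<iota>. F dvd w * (1 * 1 - p * map_poly \<iota> g)"
      unfolding frac_class_eq_iff[OF g one_in_Sloc] .
    then have "frac_class \<iota> F 1 1 = frac_class \<iota> F (p * map_poly \<iota> g) 1"
      unfolding frac_class_eq_iff[OF one_in_Sloc one_in_Sloc] by simp
    then have "frac_class \<iota> F (p * map_poly \<iota> g) 1 = frac_class \<iota> F 1 1" ..
    then have "F dvd p * map_poly \<iota> g - 1"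
      using conjunct2[OF *] by (simp only:)
    then show "\<exists>h. F dvd map_poly \<iota> g * h - 1" by (auto simp: mult.commute)
  qed
qed

end

definition poly_of_coeffs :: "nat \<Rightarrow> (nat \<Rightarrow> 'a::comm_ring_1) \<Rightarrow> 'a poly" where
  "poly_of_coeffs n c = (\<Sum>i<n. Polynomial.monom (c i) i)"

lemma coeff_poly_of_coeffs:
  "Polynomial.coeff (poly_of_coeffs n c) i = (if i < n then c i else 0)"
  by (simp add: poly_of_coeffs_def coeff_sum if_distrib)

lemma poly_of_coeffs_coeff:
  assumes "\<And>i. n \<le> i \<Longrightarrow> Polynomial.coeff p i = 0"
  shows "poly_of_coeffs n (restrict (Polynomial.coeff p) {0..<n}) = p"
  by (rule poly_eqI) (use assms in \<open>auto simp: coeff_poly_of_coeffs\<close>)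

lemma poly_of_coeffs_inj:
  assumes "c \<in> {0..<n} \<rightarrow>\<^sub>E A" "d \<in> {0..<n} \<rightarrow>\<^sub>E A" "poly_of_coeffs n c = poly_of_coeffs n d"
  shows "c = d"
proof (rule PiE_ext[OF assms(1,2)])
  fix i assume "i \<in> {0..<n}"
  then show "c i = d i"
    using arg_cong[OF assms(3), of "\<lambda>p. Polynomial.coeff p i"] by (simp add: coeff_poly_of_coeffs)
qed

text \<open>A[x]/(F) is free on 1, ..., x^(n-1), as every class contains exactly one polynomial with
  no terms in degree \<open>n\<close> or above. Existence of coordinates in the localized quotient
  therefore amounts to surjectivity of the fraction map, and their uniqueness to
  injectivity.\<close>

lemma frac_map_iso_iff_basis:
  fixes \<iota> :: "'k::field \<Rightarrow> 'a::comm_ring_1"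
  assumes \<iota>: "comm_ring_hom \<iota>" and F: "Polynomial.lead_coeff F = 1" and n: "Polynomial.degree F = n"
  shows "(\<forall>Z\<in>LQ \<iota> F. \<exists>p. Z = frac_class \<iota> F p 1) \<and>
     (\<forall>p q. frac_class \<iota> F p 1 = frac_class \<iota> F q 1 \<longleftrightarrow> F dvd p - q) \<longleftrightarrow>
   (\<forall>Z\<in>LQ \<iota> F. \<exists>!c. c \<in> {0..<n} \<rightarrow>\<^sub>E UNIV \<and> Z = frac_class \<iota> F (poly_of_coeffs n c) 1)"
   (is "?iso \<longleftrightarrow> ?basis")
proof -
  have dvd_imp: "frac_class \<iota> F p 1 = frac_class \<iota> F q 1" if "F dvd p - q" for p q
    unfolding frac_class_eq_iff[OF \<iota> one_in_Sloc[OF \<iota>] one_in_Sloc[OF \<iota>]]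
    using that one_in_Sloc[OF \<iota>] by (auto intro!: bexI[of _ 1])
  \<comment> \<open>The restriction fixes the values outside {0..<n}, as the extensional function
    space demands; this is what makes uniqueness of \<open>c\<close> meaningful.\<close>
  define cf where "cf p = restrict (Polynomial.coeff (monic_mod F p)) {0..<n}" for p
  have cf: "cf p \<in> {0..<n} \<rightarrow>\<^sub>E UNIV" "poly_of_coeffs n (cf p) = monic_mod F p" for p
    by (auto simp: cf_def n intro!: poly_of_coeffs_coeff coeff_monic_mod_eq_0[OF F])
  have cf_class: "frac_class \<iota> F p 1 = frac_class \<iota> F (poly_of_coeffs n (cf p)) 1" for p
    unfolding cf by (rule dvd_imp[OF monic_dvd_diff_monic_mod[OF F]])
  have small: "monic_mod F (poly_of_coeffs n c) = poly_of_coeffs n c" for c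
    by (rule monic_mod_small[OF F]) (simp add: n coeff_poly_of_coeffs)
  show ?thesis
  proof
    assume *: ?iso
    show ?basis
    proof
      fix Z assume "Z \<in> LQ \<iota> F"
      from bspec[OF conjunct1[OF *] this] obtain p where Z: "Z = frac_class \<iota> F p 1" ..
      show "\<exists>!c. c \<in> {0..<n} \<rightarrow>\<^sub>E UNIV \<and> Z = frac_class \<iota> F (poly_of_coeffs n c) 1"
      proof (rule ex1I[of _ "cf p"])
        show "cf p \<in> {0..<n} \<rightarrow>\<^sub>E UNIV \<and> Z = frac_class \<iota> F (poly_of_coeffs n (cf p)) 1"
          using cf(1) cf_class Z by simp
        fix c assume c: "c \<in> {0..<n} \<rightarrow>\<^sub>E UNIV \<and> Z = frac_class \<iota> F (poly_of_coeffs n c) 1"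
        then have "frac_class \<iota> F (poly_of_coeffs n c) 1 = frac_class \<iota> F p 1" using Z by simp
        then have "F dvd poly_of_coeffs n c - p" using conjunct2[OF *] by (simp only:)
        then have "poly_of_coeffs n c = poly_of_coeffs n (cf p)"
          using monic_mod_eq_iff[OF F] small cf(2) by metis
        then show "c = cf p" using c cf(1) by (intro poly_of_coeffs_inj) auto
      qed
    qed
  next
    assume *: ?basis
    have "F dvd p - q" if "frac_class \<iota> F p 1 = frac_class \<iota> F q 1" for p q
    proof -
      have "frac_class \<iota> F p 1 \<in> LQ \<iota> F" by (rule frac_class_in_LQ[OF \<iota> one_in_Sloc[OF \<iota>]])
      with * have "\<exists>!c. c \<in> {0..<n} \<rightarrow>\<^sub>E UNIV \<and>
        frac_class \<iota> F p 1 = frac_class \<iota> F (poly_of_coeffs n c) 1" by (rule bspec)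
      moreover have "frac_class \<iota> F p 1 = frac_class \<iota> F (poly_of_coeffs n (cf q)) 1"
        using that cf_class[of q] by simp
      ultimately have "cf p = cf q" using cf(1) cf_class[of p] by blast
      then show ?thesis using cf(2) monic_mod_eq_iff[OF F] by metis
    qed
    with dvd_imp have "\<forall>p q. frac_class \<iota> F p 1 = frac_class \<iota> F q 1 \<longleftrightarrow> F dvd p - q"
      by (intro allI iffI)
    moreover have "\<forall>Z\<in>LQ \<iota> F. \<exists>p. Z = frac_class \<iota> F p 1"
    proof
      fix Z assume "Z \<in> LQ \<iota> F"
      from bspec[OF * this] show "\<exists>p. Z = frac_class \<iota> F p 1" by (elim ex1E conjE) (rule exI)
    qed
    ultimately show ?iso by (intro conjI)
  qed
qed
section \<open>Reduction to the residue fields\<close>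


text \<open>A homomorphism from a type-class ring into a domain given as a structure. Besides
  residue maps, the instances include the composite into an algebraic closure, the coefficientwise
  reduction of polynomials and the evaluation at a point, so that \<open>hom_simps\<close> is
  available for all of them.\<close>

locale poly_reduction = domain R for R (structure) +
  fixes \<theta> :: "'c::comm_ring_1 \<Rightarrow> 'a"
  assumes hom: "\<theta> \<in> Ring.ring_hom RA R"
begin

lemma hom_simps [simp]:
  "\<theta> a \<in> carrier R" "\<theta> (a + b) = \<theta> a \<oplus> \<theta> b" "\<theta> (a * b) = \<theta> a \<otimes> \<theta> b" "\<theta> 1 = \<one>" "\<theta> 0 = \<zero>"
  using ring_hom_memE[OF hom] ring_hom_zero[OF hom cring.axioms(1)[OF cring_RA] ring_axioms]
  by auto

lemma hom_uminus [simp]: "\<theta> (- a) = \<ominus> \<theta> a"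
proof -
  have "\<theta> (- a) \<oplus> \<theta> a = \<zero>" by (simp flip: hom_simps(2))
  then show ?thesis by (simp add: sum_zero_eq_neg)
qed

lemma hom_diff [simp]: "\<theta> (a - b) = \<theta> a \<ominus> \<theta> b"
  using hom_simps(2)[of a "- b"] by (simp add: minus_eq del: hom_simps(2))

lemma hom_sum: "finite A \<Longrightarrow> \<theta> (\<Sum>k\<in>A. f k) = (\<Oplus>k\<in>A. \<theta> (f k))"
  by (induction A rule: finite_induct) auto

text \<open>\<open>normalize\<close> strips the leading zeros that arise when
  \<open>\<theta>\<close> kills leading coefficients.\<close>

definition red :: "'c poly \<Rightarrow> 'a list" where
  "red p = normalize (polymap \<theta> p)"

lemma set_polymap: "set (polymap \<theta> p) \<subseteq> carrier R"
  by (auto simp: polymap_def)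

lemma coeff_polymap: "coeff (polymap \<theta> p) i = \<theta> (Polynomial.coeff p i)"
proof (cases "i < length (coeffs p)")
  case True
  then have "length (coeffs p) - Suc (length (coeffs p) - Suc i) = i" by simp
  with True show ?thesis
    by (simp add: coeff_nth polymap_def rev_nth nth_default_nth flip: nth_default_coeffs_eq)
next
  case False
  then show ?thesis
    using coeff_length[of "polymap \<theta> p" i]
    by (simp add: polymap_def nth_default_beyond flip: nth_default_coeffs_eq)
qed

lemma red_closed [simp]: "red p \<in> carrier (poly_ring R)"
  unfolding red_def univ_poly_carrier[symmetric]
  by (rule normalize_gives_polynomial[OF set_polymap])

lemma set_red: "set (red p) \<subseteq> carrier R"
  unfolding red_def by (rule normalize_in_carrier[OF set_polymap])

lemma coeff_red: "coeff (red p) i = \<theta> (Polynomial.coeff p i)"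
  unfolding red_def normalize_coeff[symmetric] by (rule coeff_polymap)

lemma red_eqI:
  assumes "l \<in> carrier (poly_ring R)" "\<And>i. coeff l i = \<theta> (Polynomial.coeff p i)"
  shows "red p = l"
  using coeff_iff_polynomial_cond[of "carrier R" "red p" l] assms red_closed[of p]
  by (auto simp: univ_poly_carrier coeff_red)

lemma red_add: "red (p + q) = red p \<oplus>\<^bsub>poly_ring R\<^esub> red q"
proof (rule red_eqI)
  interpret UP: domain "poly_ring R" by (rule univ_poly_is_domain[OF carrier_is_subring])
  show "red p \<oplus>\<^bsub>poly_ring R\<^esub> red q \<in> carrier (poly_ring R)" by simp
  show "coeff (red p \<oplus>\<^bsub>poly_ring R\<^esub> red q) i = \<theta> (Polynomial.coeff (p + q) i)" for i
    using poly_add_coeff[OF set_red set_red, of p q] by (simp add: univ_poly_add coeff_red)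
qed

lemma red_mult: "red (p * q) = red p \<otimes>\<^bsub>poly_ring R\<^esub> red q"
proof (rule red_eqI)
  interpret UP: domain "poly_ring R" by (rule univ_poly_is_domain[OF carrier_is_subring])
  show "red p \<otimes>\<^bsub>poly_ring R\<^esub> red q \<in> carrier (poly_ring R)" by simp
  show "coeff (red p \<otimes>\<^bsub>poly_ring R\<^esub> red q) i = \<theta> (Polynomial.coeff (p * q) i)" for i
    using poly_mult_coeff[OF set_red set_red, of p q]
    by (simp add: univ_poly_mult coeff_red coeff_mult hom_sum del: poly_mult.simps)
qed

lemma red_1: "red 1 = \<one>\<^bsub>poly_ring R\<^esub>"
  by (simp add: red_def polymap_def univ_poly_one)

lemma red_hom: "red \<in> Ring.ring_hom RA (poly_ring R)"
  by (rule ring_hom_memI) (simp_all add: red_mult red_add red_1)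

lemma red_minus: "red (p - q) = red p \<ominus>\<^bsub>poly_ring R\<^esub> red q"
proof -
  \<comment> \<open>Reduction of polynomials is itself a homomorphism from a type into a domain, so
    the difference rule of the locale applies to it.\<close>
  interpret UP: poly_reduction "poly_ring R" red
    by (intro poly_reduction.intro poly_reduction_axioms.intro red_hom
      univ_poly_is_domain[OF carrier_is_subring])
  show ?thesis by (rule UP.hom_diff)
qed

text \<open>The leading 1 maps to 1, so nothing has to be stripped and the plain list
  \<open>polymap \<theta> F\<close> is already a polynomial over \<open>R\<close>.\<close>

lemma red_monic:
  assumes "Polynomial.lead_coeff F = 1"
  shows "red F = polymap \<theta> F"
proof -
  from assms have "F \<noteq> 0" by auto
  then have "coeffs F \<noteq> []" by simp
  then have "polymap \<theta> F \<noteq> []" "hd (polymap \<theta> F) = \<one>"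
    using assms by (simp_all add: polymap_def hd_map hd_rev last_coeffs_eq_coeff_degree \<open>F \<noteq> 0\<close>)
  then show ?thesis unfolding red_def by (cases "polymap \<theta> F") auto
qed

abbreviation ker :: "'c set" where
  "ker \<equiv> {a. \<theta> a = \<zero>}"

lemma typed_ideal_ker: "typed_ideal ker"
  by (auto simp: typed_ideal_def)

lemma red_eq_iff: "red p = red q \<longleftrightarrow> ideal_poly ker (p - q)"
proof -
  have "red p = red q \<longleftrightarrow> (\<forall>i. \<theta> (Polynomial.coeff p i) = \<theta> (Polynomial.coeff q i))"
    by (metis coeff_red red_closed red_eqI)
  then show ?thesis by (simp add: ideal_poly_def[OF typed_ideal_ker])
qed

lemma eval_red: "x \<in> carrier R \<Longrightarrow> eval (polymap \<theta> p) x = eval (red p) x"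
  unfolding red_def by (rule eval_normalize[OF set_polymap, symmetric])

lemma poly_reduction_eval:
  assumes x: "x \<in> carrier R"
  shows "poly_reduction R (\<lambda>p. eval (polymap \<theta> p) x)"
proof (intro poly_reduction.intro poly_reduction_axioms.intro domain_axioms ring_hom_memI)
  fix p q :: "'c poly"
  show "eval (polymap \<theta> p) x \<in> carrier R" by (rule eval_in_carrier[OF set_polymap x])
  show "eval (polymap \<theta> (p \<otimes>\<^bsub>RA\<^esub> q)) x = eval (polymap \<theta> p) x \<otimes> eval (polymap \<theta> q) x"
    using eval_poly_mult[OF set_red set_red x, of p q]
    by (simp add: eval_red[OF x] red_mult univ_poly_mult del: poly_mult.simps)
  show "eval (polymap \<theta> (p \<oplus>\<^bsub>RA\<^esub> q)) x = eval (polymap \<theta> p) x \<oplus> eval (polymap \<theta> q) x"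
    using eval_poly_add[OF set_red set_red x, of p q]
    by (simp add: eval_red[OF x] red_add univ_poly_add del: poly_add.simps)
  show "eval (polymap \<theta> \<one>\<^bsub>RA\<^esub>) x = \<one>"
    using x by (simp add: polymap_def)
qed

end

section \<open>The localized quotient over the residue field\<close>

text \<open>Surjectivity of \<open>\<theta>\<close> allows every polynomial over \<open>R\<close> to
  be lifted, so that all computations take place in the type-class polynomial ring modulo the
  kernel.\<close>

locale residue_reduction = poly_reduction R \<theta> for R (structure) and \<theta> :: "'c::comm_ring_1 \<Rightarrow> 'a" +
  fixes \<iota> :: "'k::field \<Rightarrow> 'c" and F :: "'c poly" and n :: nat
  assumes surj: "carrier R \<subseteq> range \<theta>"
    and \<iota>: "comm_ring_hom \<iota>"
    and monic: "Polynomial.lead_coeff F = 1"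
    and degree_F: "Polynomial.degree F = n"
begin

lemma \<iota>_nonzero: "x \<noteq> 0 \<Longrightarrow> \<iota> x \<noteq> 0"
proof
  interpret comm_ring_hom \<iota> by (rule \<iota>)
  assume "x \<noteq> 0" "\<iota> x = 0"
  then show False using hom_mult[of x "inverse x"] by simp
qed

lemma polymap_\<iota>: "polymap \<theta> (map_poly \<iota> g) = map (\<theta> \<circ> \<iota>) (rev (coeffs g))"
  by (simp add: polymap_def coeffs_map_poly'[OF \<iota>_nonzero] rev_map)

lemma SlocR_eq: "SlocR R (\<theta> \<circ> \<iota>) = red ` Sloc \<iota>"
proof -
  have "red ` Sloc \<iota> = {red (map_poly \<iota> g) |g. Polynomial.poly g 0 \<noteq> 0}" by (auto simp: Sloc_def)
  then show ?thesis by (simp only: SlocR_def red_def polymap_\<iota>)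
qed

lemma red_surj:
  assumes l: "l \<in> carrier (poly_ring R)"
  obtains p where "red p = l"
proof -
  have "set l \<subseteq> carrier R" using l polynomial_incl unfolding univ_poly_carrier[symmetric] by blast
  then have "coeff l i \<in> range \<theta>" for i using surj coeff_in_carrier[of l i] by blast
  then have "\<exists>a. \<theta> a = coeff l i" for i by (metis imageE)
  then obtain f where f: "\<And>i. \<theta> (f i) = coeff l i" by metis
  have "red (poly_of_coeffs (length l) f) = l"
    by (rule red_eqI[OF l]) (simp add: coeff_poly_of_coeffs f coeff_length)
  then show ?thesis by (rule that)
qed

text \<open>The ideal generated by \<open>F\<close> and the polynomials with coefficients in the
  kernel, that is, the preimage of the ideal of the reduced \<open>F\<close>. It takes over the role
  of divisibility by \<open>F\<close>.\<close>

definition in_J :: "'c poly \<Rightarrow> bool" where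
  "in_J p \<longleftrightarrow> (\<exists>r. ideal_poly ker (p - F * r))"

lemma in_J_iff_divides: "in_J p \<longleftrightarrow> polymap \<theta> F divides\<^bsub>poly_ring R\<^esub> red p"
proof
  assume "in_J p"
  then obtain r where "red p = red (F * r)" by (auto simp: in_J_def red_eq_iff)
  then show "polymap \<theta> F divides\<^bsub>poly_ring R\<^esub> red p"
    by (auto simp: factor_def red_mult red_monic[OF monic])
next
  assume "polymap \<theta> F divides\<^bsub>poly_ring R\<^esub> red p"
  then obtain c where "c \<in> carrier (poly_ring R)" "red p = red F \<otimes>\<^bsub>poly_ring R\<^esub> c"
    by (auto simp: factor_def red_monic[OF monic])
  moreover from this(1) obtain r where "red r = c" by (rule red_surj)
  ultimately show "in_J p" by (auto simp: in_J_def red_mult simp flip: red_eq_iff)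
qed

lemmas ideal_poly_ker_closed = ideal_poly_closed[OF typed_ideal_ker]

lemma in_J_add: "in_J p \<Longrightarrow> in_J q \<Longrightarrow> in_J (p + q)"
  unfolding in_J_def
proof (elim exE)
  fix r s assume "ideal_poly ker (p - F * r)" "ideal_poly ker (q - F * s)"
  then have "ideal_poly ker ((p - F * r) + (q - F * s))" by (rule ideal_poly_ker_closed)
  also have "(p - F * r) + (q - F * s) = (p + q) - F * (r + s)" by (simp add: algebra_simps)
  finally show "\<exists>r. ideal_poly ker ((p + q) - F * r)" ..
qed

lemma in_J_mult: "in_J q \<Longrightarrow> in_J (p * q)"
  unfolding in_J_def
proof (elim exE)
  fix r assume "ideal_poly ker (q - F * r)"
  then have "ideal_poly ker (p * (q - F * r))" by (rule ideal_poly_ker_closed)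
  also have "p * (q - F * r) = p * q - F * (p * r)" by (simp add: algebra_simps)
  finally show "\<exists>r. ideal_poly ker (p * q - F * r)" ..
qed

lemma in_J_uminus: "in_J p \<Longrightarrow> in_J (- p)"
  using in_J_mult[of p "- 1"] by simp

lemma in_J_diff: "in_J p \<Longrightarrow> in_J q \<Longrightarrow> in_J (p - q)"
  using in_J_add[of p "- q"] in_J_uminus[of q] by simp

lemma in_J_0: "in_J 0"
  unfolding in_J_def using ideal_poly_ker_closed(1) by (auto intro!: exI[of _ 0])

lemma in_J_diff_monic_mod: "in_J (p - monic_mod F p)"
proof -
  obtain q where "p = F * q + monic_mod F p" using monic_mod_decomp[OF monic] .
  then have "p - monic_mod F p - F * q = 0" by (simp add: algebra_simps)
  then show ?thesis unfolding in_J_def using ideal_poly_ker_closed(1) by metis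
qed

text \<open>For degree reasons \<open>p\<close> is the remainder of \<open>p - F * r\<close> modulo
  \<open>F\<close>, and taking remainders keeps all coefficients in the kernel.\<close>

lemma in_J_small:
  assumes "in_J p" "\<And>i. n \<le> i \<Longrightarrow> Polynomial.coeff p i = 0"
  shows "ideal_poly ker p"
proof -
  obtain r where r: "ideal_poly ker (p - F * r)" using assms(1) by (auto simp: in_J_def)
  have "monic_mod F (p - F * r) = p"
    by (rule monic_mod_unique[OF monic, where q = "- r"]) (use assms(2) degree_F in auto)
  with ideal_poly_monic_mod[OF typed_ideal_ker monic r] show ?thesis by simp
qed

abbreviation rel :: "(('a list \<times> 'a list) \<times> ('a list \<times> 'a list)) set" where
  "rel \<equiv> loc_relR R (\<theta> \<circ> \<iota>) (polymap \<theta> F)"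

abbreviation cls :: "'c poly \<Rightarrow> 'c poly \<Rightarrow> ('a list \<times> 'a list) set" where
  "cls p s \<equiv> rel `` {(red p, red s)}"

lemma rel_iff:
  assumes "s \<in> Sloc \<iota>" "t \<in> Sloc \<iota>"
  shows "((red p, red s), (red q, red t)) \<in> rel \<longleftrightarrow> (\<exists>w\<in>Sloc \<iota>. in_J (w * (p * t - q * s)))"
  using assms by (simp add: loc_relR_def SlocR_eq in_J_iff_divides red_mult red_minus)

lemma rel_cases:
  assumes "a \<in> carrier (poly_ring R) \<times> SlocR R (\<theta> \<circ> \<iota>)"
  obtains p s where "s \<in> Sloc \<iota>" "a = (red p, red s)"
proof -
  from assms obtain l s where "a = (l, red s)" "l \<in> carrier (poly_ring R)" "s \<in> Sloc \<iota>"
    by (auto simp: SlocR_eq)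
  moreover from this(2) obtain p where "red p = l" by (rule red_surj)
  ultimately show ?thesis using that by blast
qed

lemma equiv_rel: "equiv (carrier (poly_ring R) \<times> SlocR R (\<theta> \<circ> \<iota>)) rel" (is "equiv ?A _")
proof (rule equivI)
  show sub: "rel \<subseteq> ?A \<times> ?A" by (auto simp: loc_relR_def)
  show "refl_on ?A rel"
  proof (rule refl_onI)
    fix a assume "a \<in> ?A"
    then show "(a, a) \<in> rel"
      by (rule rel_cases) (use one_in_Sloc[OF \<iota>] in_J_0 in \<open>auto simp: rel_iff\<close>)
  qed
  show "sym rel"
  proof (rule symI)
    fix a b assume ab: "(a, b) \<in> rel"
    then have "a \<in> ?A" "b \<in> ?A" using sub by auto
    from this(1) obtain p s where s: "s \<in> Sloc \<iota>" and [simp]: "a = (red p, red s)" by (rule rel_cases)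
    from \<open>b \<in> ?A\<close> obtain q t where t: "t \<in> Sloc \<iota>" and [simp]: "b = (red q, red t)" by (rule rel_cases)
    note S = s t
    from ab S obtain w where w: "w \<in> Sloc \<iota>" "in_J (w * (p * t - q * s))" by (auto simp: rel_iff)
    have "w * (q * s - p * t) = - (w * (p * t - q * s))" by (simp add: algebra_simps)
    with in_J_uminus[OF w(2)] have "in_J (w * (q * s - p * t))" by simp
    with w(1) S show "(b, a) \<in> rel" by (auto simp: rel_iff)
  qed
  show "trans rel"
  proof (rule transI)
    fix a b c assume ab: "(a, b) \<in> rel" and bc: "(b, c) \<in> rel"
    then have "a \<in> ?A" "b \<in> ?A" "c \<in> ?A" using sub by auto
    from this(1) obtain p s where s: "s \<in> Sloc \<iota>" and [simp]: "a = (red p, red s)" by (rule rel_cases)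
    from \<open>b \<in> ?A\<close> obtain q t where t: "t \<in> Sloc \<iota>" and [simp]: "b = (red q, red t)" by (rule rel_cases)
    from \<open>c \<in> ?A\<close> obtain r v where v: "v \<in> Sloc \<iota>" and [simp]: "c = (red r, red v)" by (rule rel_cases)
    from ab bc s t v obtain w w' where w: "w \<in> Sloc \<iota>" "w' \<in> Sloc \<iota>"
      and d: "in_J (w * (p * t - q * s))" "in_J (w' * (q * v - r * t))"
      by (auto simp: rel_iff)
    have "w * w' * t * (p * v - r * s) = w' * v * (w * (p * t - q * s)) + w * s * (w' * (q * v - r * t))"
      by (simp add: algebra_simps)
    then have "in_J (w * w' * t * (p * v - r * s))" using d by (metis in_J_add in_J_mult)
    moreover have "w * w' * t \<in> Sloc \<iota>" using w t by (intro mult_in_Sloc[OF \<iota>])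
    ultimately show "(a, c) \<in> rel" using s v by (auto simp: rel_iff)
  qed
qed

lemma cls_eq_iff:
  assumes "s \<in> Sloc \<iota>" "t \<in> Sloc \<iota>"
  shows "cls p s = cls q t \<longleftrightarrow> (\<exists>w\<in>Sloc \<iota>. in_J (w * (p * t - q * s)))"
proof -
  have "cls p s = cls q t \<longleftrightarrow> ((red p, red s), (red q, red t)) \<in> rel"
    by (rule eq_equiv_class_iff[OF equiv_rel]) (use assms in \<open>auto simp: SlocR_eq\<close>)
  with rel_iff[OF assms] show ?thesis by simp
qed

lemma cls_in_LQR: "s \<in> Sloc \<iota> \<Longrightarrow> cls p s \<in> LQR R (\<theta> \<circ> \<iota>) (polymap \<theta> F)"
  unfolding LQR_def by (rule quotientI) (auto simp: SlocR_eq)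

lemma LQR_cases:
  assumes "Z \<in> LQR R (\<theta> \<circ> \<iota>) (polymap \<theta> F)"
  obtains p s where "s \<in> Sloc \<iota>" "Z = cls p s"
proof -
  from assms obtain a where "a \<in> carrier (poly_ring R) \<times> SlocR R (\<theta> \<circ> \<iota>)" and Z: "Z = rel `` {a}"
    unfolding LQR_def by (rule quotientE)
  from this(1) obtain p s where "s \<in> Sloc \<iota>" "a = (red p, red s)" by (rule rel_cases)
  with Z show ?thesis by (intro that) auto
qed

lemma cls_1_eqI: "in_J (p - q) \<Longrightarrow> cls p 1 = cls q 1"
  unfolding cls_eq_iff[OF one_in_Sloc[OF \<iota>] one_in_Sloc[OF \<iota>]]
  using one_in_Sloc[OF \<iota>] by (auto intro!: bexI[of _ 1])

lemma poly_of_coeffsR_eq: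
  assumes "\<And>i. i < n \<Longrightarrow> c i = \<theta> (f i)"
  shows "poly_of_coeffsR R n c = red (poly_of_coeffs n f)"
proof (rule red_eqI[symmetric])
  let ?l = "rev (map c [0..<n])"
  have set: "set ?l \<subseteq> carrier R" using assms by auto
  then show "poly_of_coeffsR R n c \<in> carrier (poly_ring R)"
    unfolding poly_of_coeffsR_def univ_poly_carrier[symmetric] by (rule normalize_gives_polynomial)
  show "coeff (poly_of_coeffsR R n c) i = \<theta> (Polynomial.coeff (poly_of_coeffs n f) i)" for i
  proof (cases "i < n")
    case True
    then show ?thesis
      unfolding poly_of_coeffsR_def normalize_coeff[symmetric]
      by (simp add: coeff_nth rev_nth coeff_poly_of_coeffs assms)
  next
    case False
    then show ?thesis
      unfolding poly_of_coeffsR_def normalize_coeff[symmetric]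
      using coeff_length[of ?l i] by (simp add: coeff_poly_of_coeffs)
  qed
qed

text \<open>Given inverses, p/s = p h has the coordinates of a remainder, and witnesses can be
  cancelled. Conversely, the coordinates of 1/g lift to a polynomial p, and uniqueness of
  coordinates turns equality of the classes of p g and 1 into a congruence.\<close>

lemma basis_iff_inverse_mod:
  "(\<forall>Z \<in> LQR R (\<theta> \<circ> \<iota>) (polymap \<theta> F). \<exists>!c. c \<in> {0..<n} \<rightarrow>\<^sub>E carrier R \<and>
      Z = rel `` {(poly_of_coeffsR R n c, \<one>\<^bsub>poly_ring R\<^esub>)}) \<longleftrightarrow>
   (\<forall>g. Polynomial.poly g 0 \<noteq> 0 \<longrightarrow> (\<exists>h. in_J (map_poly \<iota> g * h - 1)))"
   (is "?basis \<longleftrightarrow> ?inv")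
proof -
  define cf where "cf p = restrict (\<lambda>i. \<theta> (Polynomial.coeff (monic_mod F p) i)) {0..<n}" for p
  have small: "Polynomial.coeff (monic_mod F p) i = 0" if "n \<le> i" for p i
    using that by (simp add: coeff_monic_mod_eq_0[OF monic] degree_F)
  have cf_mem: "cf p \<in> {0..<n} \<rightarrow>\<^sub>E carrier R" for p by (auto simp: cf_def)
  have cf_red: "poly_of_coeffsR R n (cf p) = red (monic_mod F p)" for p
  proof -
    have "poly_of_coeffsR R n (cf p) =
      red (poly_of_coeffs n (restrict (Polynomial.coeff (monic_mod F p)) {0..<n}))"
      by (rule poly_of_coeffsR_eq) (simp add: cf_def)
    then show ?thesis by (simp add: poly_of_coeffs_coeff small)
  qed
  have cf_cls: "rel `` {(poly_of_coeffsR R n (cf p), \<one>\<^bsub>poly_ring R\<^esub>)} = cls p 1" for p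
    using cls_1_eqI[OF in_J_diff_monic_mod, of p] by (simp add: cf_red red_1)
  have cf_inv: "\<exists>p. c = cf p" if "c \<in> {0..<n} \<rightarrow>\<^sub>E carrier R" for c
  proof -
    have "\<exists>a. \<theta> a = c i" if "i < n" for i
    proof -
      have "c i \<in> range \<theta>" using surj PiE_mem[OF \<open>c \<in> _\<close>, of i] that by auto
      then show ?thesis by (metis imageE)
    qed
    then obtain f where f: "\<And>i. i < n \<Longrightarrow> \<theta> (f i) = c i" by metis
    have "monic_mod F (poly_of_coeffs n f) = poly_of_coeffs n f"
      by (rule monic_mod_small[OF monic]) (simp add: degree_F coeff_poly_of_coeffs)
    then have "c = cf (poly_of_coeffs n f)"
      using that by (intro PiE_ext[OF that cf_mem]) (simp add: cf_def coeff_poly_of_coeffs f)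
    then show ?thesis ..
  qed
  have cf_eq_iff: "cf p = cf q \<longleftrightarrow> in_J (p - q)" for p q
  proof
    assume eq: "cf p = cf q"
    have "red (monic_mod F p) = red (monic_mod F q)" using eq cf_red by metis
    then have "ideal_poly ker (monic_mod F p - monic_mod F q)" by (simp add: red_eq_iff)
    then have "in_J (monic_mod F p - monic_mod F q)" unfolding in_J_def by (intro exI[of _ 0]) simp
    then have "in_J ((p - monic_mod F p) - (q - monic_mod F q) + (monic_mod F p - monic_mod F q))"
      by (rule in_J_add[OF in_J_diff[OF in_J_diff_monic_mod in_J_diff_monic_mod]])
    then show "in_J (p - q)" by simp
  next
    assume "in_J (p - q)"
    \<comment> \<open>Discarding multiples of \<open>F\<close> leaves a difference of remainders,
      whose degree is too small for a nonzero multiple of the reduced \<open>F\<close>.\<close>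
    then have "in_J ((p - q) - (p - monic_mod F p) + (q - monic_mod F q))"
      by (rule in_J_add[OF in_J_diff[OF _ in_J_diff_monic_mod] in_J_diff_monic_mod])
    then have "in_J (monic_mod F p - monic_mod F q)" by (simp add: algebra_simps)
    then have "ideal_poly ker (monic_mod F p - monic_mod F q)"
      by (rule in_J_small) (simp add: small)
    then have "red (monic_mod F p) = red (monic_mod F q)" by (simp add: red_eq_iff)
    then have "\<theta> (Polynomial.coeff (monic_mod F p) i) = \<theta> (Polynomial.coeff (monic_mod F q) i)" for i
      by (metis coeff_red)
    then show "cf p = cf q" by (simp add: cf_def)
  qed
  show ?thesis
  proof
    assume *: ?basis
    have inj: "in_J (p - q)" if eq: "cls p 1 = cls q 1" for p q
    proof -
      from bspec[OF * cls_in_LQR[OF one_in_Sloc[OF \<iota>], of p]]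
      obtain c where "\<And>d. d \<in> {0..<n} \<rightarrow>\<^sub>E carrier R \<Longrightarrow>
        cls p 1 = rel `` {(poly_of_coeffsR R n d, \<one>\<^bsub>poly_ring R\<^esub>)} \<Longrightarrow> d = c" by (elim ex1E) blast
      from this[OF cf_mem, of p] this[OF cf_mem, of q] have "cf p = cf q"
        unfolding cf_cls using eq by simp
      then show ?thesis by (simp add: cf_eq_iff)
    qed
    show ?inv
    proof (intro allI impI)
      fix g :: "'k poly" assume "Polynomial.poly g 0 \<noteq> 0"
      then have g: "map_poly \<iota> g \<in> Sloc \<iota>" by (auto simp: Sloc_def)
      from bspec[OF * cls_in_LQR[OF g, of 1]] obtain c where c: "c \<in> {0..<n} \<rightarrow>\<^sub>E carrier R"
        "cls 1 (map_poly \<iota> g) = rel `` {(poly_of_coeffsR R n c, \<one>\<^bsub>poly_ring R\<^esub>)}"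
        by (elim ex1E) blast
      from cf_inv[OF c(1)] obtain p where "c = cf p" ..
      with c(2) have "cls 1 (map_poly \<iota> g) = cls p 1" by (simp add: cf_cls)
      then have "\<exists>w\<in>Sloc \<iota>. in_J (w * (1 * 1 - p * map_poly \<iota> g))"
        unfolding cls_eq_iff[OF g one_in_Sloc[OF \<iota>]] .
      then have "cls 1 1 = cls (p * map_poly \<iota> g) 1"
        unfolding cls_eq_iff[OF one_in_Sloc[OF \<iota>] one_in_Sloc[OF \<iota>]] by simp
      from in_J_uminus[OF inj[OF this]] show "\<exists>h. in_J (map_poly \<iota> g * h - 1)"
        by (auto simp: mult.commute)
    qed
  next
    assume ?inv
    then have inv: "\<exists>h. in_J (s * h - 1)" if "s \<in> Sloc \<iota>" for s
      using that by (auto simp: Sloc_def)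
    show ?basis
    proof
      fix Z assume "Z \<in> LQR R (\<theta> \<circ> \<iota>) (polymap \<theta> F)"
      then obtain p s where s: "s \<in> Sloc \<iota>" and Z: "Z = cls p s" by (rule LQR_cases)
      from inv[OF s] obtain h where "in_J (s * h - 1)" ..
      then have "in_J ((- p) * (s * h - 1))" by (rule in_J_mult)
      also have "(- p) * (s * h - 1) = 1 * (p * 1 - p * h * s)" by (simp add: algebra_simps)
      finally have Zph: "Z = cls (p * h) 1"
        unfolding Z cls_eq_iff[OF s one_in_Sloc[OF \<iota>]] using one_in_Sloc[OF \<iota>] by blast
      have inj: "in_J (q - p * h)" if eq: "cls q 1 = cls (p * h) 1" for q
      proof -
        from eq obtain w where w: "w \<in> Sloc \<iota>" "in_J (w * (q - p * h))"
          unfolding cls_eq_iff[OF one_in_Sloc[OF \<iota>] one_in_Sloc[OF \<iota>]] by auto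
        from inv[OF w(1)] obtain v where v: "in_J (w * v - 1)" ..
        \<comment> \<open>The witness \<open>w\<close> is itself a denominator, so its inverse
          \<open>v\<close> cancels it.\<close>
        have "q - p * h = v * (w * (q - p * h)) - (q - p * h) * (w * v - 1)" by (simp add: algebra_simps)
        then show ?thesis using w(2) v by (metis in_J_diff in_J_mult)
      qed
      show "\<exists>!c. c \<in> {0..<n} \<rightarrow>\<^sub>E carrier R \<and>
        Z = rel `` {(poly_of_coeffsR R n c, \<one>\<^bsub>poly_ring R\<^esub>)}"
      proof (rule ex1I[of _ "cf (p * h)"])
        show "cf (p * h) \<in> {0..<n} \<rightarrow>\<^sub>E carrier R \<and>
          Z = rel `` {(poly_of_coeffsR R n (cf (p * h)), \<one>\<^bsub>poly_ring R\<^esub>)}"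
          unfolding cf_cls using cf_mem Zph by blast
        fix c assume c: "c \<in> {0..<n} \<rightarrow>\<^sub>E carrier R \<and>
          Z = rel `` {(poly_of_coeffsR R n c, \<one>\<^bsub>poly_ring R\<^esub>)}"
        from cf_inv[OF conjunct1[OF c]] obtain q where q: "c = cf q" ..
        with c Zph have "cls q 1 = cls (p * h) 1" by (simp add: cf_cls)
        with q show "c = cf (p * h)" by (simp add: cf_eq_iff inj)
      qed
    qed
  qed
qed

end
section \<open>Roots in an algebraic closure\<close>


locale geometric_reduction =
  residue_reduction R \<theta> \<iota> F n + R: field R + L: algebraically_closed L
  for R (structure) and \<theta> :: "'c::comm_ring_1 \<Rightarrow> 'a" and \<iota> :: "'k::field \<Rightarrow> 'c" and F n
    and L :: "('l, 'm) ring_scheme" +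
  fixes e :: "'a \<Rightarrow> 'l"
  assumes e: "e \<in> Ring.ring_hom R L"
begin

sublocale e: ring_hom_ring R L e
  by (rule ring_hom_ringI2[OF ring_axioms L.ring_axioms e])

sublocale Lred: poly_reduction L "e \<circ> \<theta>"
  by (intro poly_reduction.intro poly_reduction_axioms.intro ring_hom_trans[OF hom e] L.domain_axioms)

lemma e_nonzero:
  assumes "a \<in> carrier R" "a \<noteq> \<zero>"
  shows "e a \<noteq> \<zero>\<^bsub>L\<^esub>"
proof
  assume "e a = \<zero>\<^bsub>L\<^esub>"
  have a: "a \<in> Units R" using assms R.field_Units by simp
  then have "e (a \<otimes> inv a) = e a \<otimes>\<^bsub>L\<^esub> e (inv a)" using assms by (intro e.hom_mult) auto
  with a \<open>e a = \<zero>\<^bsub>L\<^esub>\<close> show False by simp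
qed

lemma \<theta>_\<iota>_nonzero:
  assumes "c \<noteq> 0"
  shows "\<theta> (\<iota> c) \<noteq> \<zero>"
proof
  interpret \<iota>: comm_ring_hom \<iota> by (rule \<iota>)
  assume "\<theta> (\<iota> c) = \<zero>"
  moreover have "\<theta> (\<iota> (c * inverse c)) = \<theta> (\<iota> c) \<otimes> \<theta> (\<iota> (inverse c))"
    by (simp only: \<iota>.hom_mult hom_simps)
  ultimately show False using assms by simp
qed

abbreviation ev :: "'l \<Rightarrow> 'c poly \<Rightarrow> 'l" where
  "ev x p \<equiv> L.eval (polymap (e \<circ> \<theta>) p) x"

text \<open>A homomorphism out of a field is injective, so \<open>e\<close> creates no leading zeros
  and the image needs no further normalization.\<close>

lemma Lred_red: "Lred.red p = map e (red p)"
proof (rule Lred.red_eqI)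
  show "L.coeff (map e (red p)) i = (e \<circ> \<theta>) (Polynomial.coeff p i)" for i
    using e.coeff_hom'[OF set_red, of p i] by (simp add: coeff_red)
  have "polynomial\<^bsub>R\<^esub> (carrier R) (red p)" using red_closed[of p] by (simp add: univ_poly_carrier)
  then have "red p = [] \<or> set (red p) \<subseteq> carrier R \<and> hd (red p) \<noteq> \<zero>" by (simp add: polynomial_def)
  then show "map e (red p) \<in> carrier (poly_ring L)"
    unfolding univ_poly_carrier[symmetric] polynomial_def
    using e_nonzero[of "hd (red p)"] by (cases "red p") auto
qed

lemma ev_cong: "x \<in> carrier L \<Longrightarrow> red p = red q \<Longrightarrow> ev x p = ev x q"
  by (simp add: Lred.eval_red Lred_red)

lemma ev_in_J:
  assumes x: "x \<in> carrier L" and F: "ev x F = \<zero>\<^bsub>L\<^esub>" and p: "in_J p"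
  shows "ev x p = \<zero>\<^bsub>L\<^esub>"
proof -
  interpret ev: poly_reduction L "ev x" by (rule Lred.poly_reduction_eval[OF x])
  from p obtain r where "red p = red (F * r)" by (auto simp: in_J_def red_eq_iff)
  then have "ev x p = ev x (F * r)" by (rule ev_cong[OF x])
  also have "\<dots> = \<zero>\<^bsub>L\<^esub>" using ev.hom_simps(3)[of F r] F by simp
  finally show ?thesis .
qed

lemma ev_pCons:
  assumes x: "x \<in> carrier L"
  shows "ev x (pCons a p) = e (\<theta> a) \<oplus>\<^bsub>L\<^esub> x \<otimes>\<^bsub>L\<^esub> ev x p"
proof -
  interpret ev: poly_reduction L "ev x" by (rule Lred.poly_reduction_eval[OF x])
  have const: "ev x [:a:] = e (\<theta> a)"
    using x Lred.hom_simps(1)[of a] by (cases "a = 0") (simp_all add: polymap_def)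
  have var: "ev x [:0, 1:] = x" using x by (simp add: polymap_def)
  have "pCons a p = [:a:] + [:0, 1:] * p" by simp
  then have "ev x (pCons a p) = ev x [:a:] \<oplus>\<^bsub>L\<^esub> ev x [:0, 1:] \<otimes>\<^bsub>L\<^esub> ev x p"
    by (simp only: ev.hom_simps)
  then show ?thesis by (simp only: const var)
qed

lemma polymap_e_\<iota>: "polymap (e \<circ> \<theta>) (map_poly \<iota> g) = map (e \<circ> \<theta> \<circ> \<iota>) (rev (coeffs g))"
  using arg_cong[OF polymap_\<iota>, of "map e" g] by (simp add: polymap_def o_assoc)

text \<open>The polynomials over the residue field form a principal ideal domain. If the generator
  of the ideal of \<open>G\<close> and \<open>F\<close> is constant, it yields a Bezout identity;
  otherwise it has a root in the algebraically closed \<open>L\<close>, and this root is common to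
  both.\<close>

lemma bezout_or_common_root:
  "(\<exists>h. in_J (G * h - 1)) \<or> (\<exists>x\<in>carrier L. ev x F = \<zero>\<^bsub>L\<^esub> \<and> ev x G = \<zero>\<^bsub>L\<^esub>)"
proof -
  interpret UP: principal_domain "poly_ring R"
    by (rule univ_poly_is_principal[OF R.carrier_is_subfield])
  let ?I = "PIdl\<^bsub>poly_ring R\<^esub> (red G) <+>\<^bsub>poly_ring R\<^esub> PIdl\<^bsub>poly_ring R\<^esub> (red F)"
  have "ideal ?I (poly_ring R)"
    by (intro UP.add_ideals UP.cgenideal_ideal red_closed)
  then obtain d0 where d0: "d0 \<in> carrier (poly_ring R)" "?I = PIdl\<^bsub>poly_ring R\<^esub> d0"
    using UP.exists_gen by blast
  \<comment> \<open>A lift of the generator, so that its relations to \<open>F\<close> and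
    \<open>G\<close> can be evaluated by \<open>ev\<close>.\<close>
  from d0(1) obtain d where d: "red d = d0" by (rule red_surj)
  have in_I: "l \<in> ?I \<longleftrightarrow> (\<exists>h q. l = red (h * G + q * F))" for l
  proof
    assume "l \<in> ?I"
    then obtain a b where "a \<in> carrier (poly_ring R)" "b \<in> carrier (poly_ring R)"
      and l: "l = a \<otimes>\<^bsub>poly_ring R\<^esub> red G \<oplus>\<^bsub>poly_ring R\<^esub> b \<otimes>\<^bsub>poly_ring R\<^esub> red F"
      by (auto simp: set_add_def' cgenideal_def)
    from this(1,2) obtain h q where "red h = a" "red q = b" using red_surj by metis
    with l show "\<exists>h q. l = red (h * G + q * F)" by (auto simp: red_add red_mult)
  next
    assume "\<exists>h q. l = red (h * G + q * F)"
    then obtain h q where "l = red (h * G) \<oplus>\<^bsub>poly_ring R\<^esub> red (q * F)" by (auto simp: red_add)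
    moreover have "red (h * G) \<in> PIdl\<^bsub>poly_ring R\<^esub> (red G)" "red (q * F) \<in> PIdl\<^bsub>poly_ring R\<^esub> (red F)"
      unfolding cgenideal_def red_mult using red_closed by blast+
    ultimately show "l \<in> ?I" unfolding set_add_def' by blast
  qed
  have dvd: "\<exists>a. red p = red (a * d)" if "red p \<in> ?I" for p
  proof -
    from that obtain c where "c \<in> carrier (poly_ring R)" "red p = c \<otimes>\<^bsub>poly_ring R\<^esub> d0"
      unfolding d0(2) by (auto simp: cgenideal_def)
    moreover from this(1) obtain a where "red a = c" by (rule red_surj)
    ultimately show ?thesis by (auto simp: red_mult d)
  qed
  have "red F \<in> ?I" unfolding in_I by (intro exI[of _ 0] exI[of _ 1]) simp
  with dvd obtain a where a: "red F = red (a * d)" by blast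
  have "red G \<in> ?I" unfolding in_I by (rule exI[of _ 1], rule exI[of _ 0]) simp
  with dvd obtain b where b: "red G = red (b * d)" by blast
  have "d0 \<in> ?I" unfolding d0(2) by (rule UP.cgenideal_self[OF d0(1)])
  then obtain h q where hq: "red d = red (h * G + q * F)" unfolding in_I d by blast
  have "d0 \<noteq> []"
  proof
    assume "d0 = []"
    then have "red F = []" using a d UP.r_null[of "red a"] by (simp add: red_mult univ_poly_zero)
    then show False using monic by (auto simp: red_monic[OF monic] polymap_def)
  qed
  have poly_d0: "set d0 \<subseteq> carrier R" "hd d0 \<noteq> \<zero>"
    using d0(1) \<open>d0 \<noteq> []\<close> unfolding univ_poly_carrier[symmetric] polynomial_def by auto
  show ?thesis
  \<comment> \<open>Nonempty polynomial lists have a nonzero head, so length 1 means a nonzero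
    constant.\<close>
  proof (cases "length d0 = 1")
    case True
    then obtain c where c: "d0 = [c]" by (auto simp: length_Suc_conv)
    then have cR: "c \<in> carrier R" "c \<noteq> \<zero>" using poly_d0 by auto
    then have cU: "c \<in> Units R" using R.field_Units by simp
    \<comment> \<open>Scaling by a lift of the inverse constant turns the generator into 1 over the
      residue field.\<close>
    have "inv c \<in> range \<theta>" using surj cU by blast
    then obtain c' where c': "\<theta> c' = inv c" by (metis imageE)
    have "red ([:c':] * d) = red 1"
    proof (rule red_eqI[OF red_closed])
      fix i
      have "\<theta> (Polynomial.coeff ([:c':] * d) i) = inv c \<otimes> coeff (red d) i"
        by (simp add: c' coeff_red)
      also have "\<dots> = (if i = 0 then \<one> else \<zero>)" using cU cR by (simp add: d c)
      also have "\<dots> = coeff (red 1) i" by (simp add: coeff_red)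
      finally show "coeff (red 1) i = \<theta> (Polynomial.coeff ([:c':] * d) i)" ..
    qed
    then have "red 1 = red ([:c':] * (h * G + q * F))" using hq by (simp only: red_mult)
    then have "ideal_poly ker ([:c':] * (h * G + q * F) - 1)"
      using red_eq_iff by metis
    also have "[:c':] * (h * G + q * F) - 1 = G * ([:c':] * h) - 1 - F * (- ([:c':] * q))"
      by (simp only: algebra_simps) simp
    finally show ?thesis unfolding in_J_def by blast
  next
    case False
    have m: "map e d0 \<in> carrier (poly_ring L)" using Lred.red_closed[of d] by (simp add: Lred_red d)
    \<comment> \<open>Over an algebraically closed field a polynomial has as many roots, with
      multiplicity, as its degree, here \<open>length d0 - 1\<close>.\<close>
    have "size (L.roots (map e d0)) = length d0 - 1"
      using L.roots_over_carrier[OF m] by (simp add: L.splitted_def)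
    also have "\<dots> \<noteq> 0" using False \<open>d0 \<noteq> []\<close> by (cases d0) auto
    finally have "L.roots (map e d0) \<noteq> {#}" by auto
    then obtain x where "x \<in># L.roots (map e d0)" by blast
    then have "L.is_root (map e d0) x" using L.roots_mem_iff_is_root[OF m] by simp
    then have x: "x \<in> carrier L" and "L.eval (map e d0) x = \<zero>\<^bsub>L\<^esub>" by (auto simp: L.is_root_def)
    then have evd: "ev x d = \<zero>\<^bsub>L\<^esub>" by (simp add: Lred.eval_red Lred_red d)
    interpret ev: poly_reduction L "ev x" by (rule Lred.poly_reduction_eval[OF x])
    have "ev x F = \<zero>\<^bsub>L\<^esub>" "ev x G = \<zero>\<^bsub>L\<^esub>"
      using ev_cong[OF x a] ev_cong[OF x b] ev.hom_simps(1)[of a] ev.hom_simps(1)[of b]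
      by (simp_all only: ev.hom_simps(3) evd L.r_null)
    with x show ?thesis by blast
  qed
qed

text \<open>At 0 the value of \<open>g\<close> is the image of the nonzero constant g(0), so 0 is
  not a root; and the coefficients of \<open>g\<close> form an algebraic relation for
  \<open>x\<close> over the image of k.\<close>

lemma algebraic_if_common_root:
  assumes x: "x \<in> carrier L" and g: "Polynomial.poly g 0 \<noteq> 0" and ev: "ev x (map_poly \<iota> g) = \<zero>\<^bsub>L\<^esub>"
  shows "x \<noteq> \<zero>\<^bsub>L\<^esub> \<and> \<not> L.transcendental (range (e \<circ> \<theta> \<circ> \<iota>)) x"
proof
  interpret \<iota>: comm_ring_hom \<iota> by (rule \<iota>)
  interpret ev: poly_reduction L "ev x" by (rule Lred.poly_reduction_eval[OF x])
  show "x \<noteq> \<zero>\<^bsub>L\<^esub>"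
  proof
    assume "x = \<zero>\<^bsub>L\<^esub>"
    obtain a q where aq: "map_poly \<iota> g = pCons a q" by (rule pCons_cases)
    have "a = \<iota> (Polynomial.poly g 0)"
      using arg_cong[OF aq, of "\<lambda>p. Polynomial.coeff p 0"] by (simp add: poly_0_coeff_0)
    then have "e (\<theta> a) \<noteq> \<zero>\<^bsub>L\<^esub>" using e_nonzero \<theta>_\<iota>_nonzero[OF g] by simp
    moreover have "ev x (pCons a q) = e (\<theta> a)"
      using ev_pCons[OF x, of a q] \<open>x = \<zero>\<^bsub>L\<^esub>\<close> ev.hom_simps(1)[of q] by simp
    ultimately show False using ev aq by simp
  qed
  show "\<not> L.transcendental (range (e \<circ> \<theta> \<circ> \<iota>)) x"
  proof
    let ?p = "map (e \<circ> \<theta> \<circ> \<iota>) (rev (coeffs g))"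
    assume "L.transcendental (range (e \<circ> \<theta> \<circ> \<iota>)) x"
    moreover have "g \<noteq> 0" using g by auto
    then have "hd ?p = e (\<theta> (\<iota> (Polynomial.lead_coeff g)))"
      by (simp add: hd_map hd_rev last_coeffs_eq_coeff_degree)
    then have "hd ?p \<noteq> \<zero>\<^bsub>L\<^esub>" using e_nonzero \<theta>_\<iota>_nonzero \<open>g \<noteq> 0\<close> by simp
    then have "?p \<in> carrier ((range (e \<circ> \<theta> \<circ> \<iota>))[X]\<^bsub>L\<^esub>)"
      unfolding univ_poly_carrier[symmetric] polynomial_def by auto
    moreover have "L.eval ?p x = \<zero>\<^bsub>L\<^esub>" using ev by (simp add: polymap_e_\<iota>)
    ultimately have "?p = []" by (intro L.eval_transcendental[unfolded over_def])
    with \<open>g \<noteq> 0\<close> show False by simp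
  qed
qed

text \<open>A relation for \<open>x\<close> over the image of k may have zero constant term.
  Dividing out the exact power of the variable leaves \<open>g\<close> with g(0) nonzero, and
  \<open>x\<close> stays a root because its powers are nonzero in \<open>L\<close>.\<close>

lemma algebraic_nonzero_imp_root:
  assumes x: "x \<in> carrier L" "x \<noteq> \<zero>\<^bsub>L\<^esub>" and alg: "\<not> L.transcendental (range (e \<circ> \<theta> \<circ> \<iota>)) x"
  obtains g where "Polynomial.poly g 0 \<noteq> 0" "ev x (map_poly \<iota> g) = \<zero>\<^bsub>L\<^esub>"
proof -
  interpret \<iota>: comm_ring_hom \<iota> by (rule \<iota>)
  interpret mp: map_poly_comm_ring_hom \<iota> ..
  interpret ev: poly_reduction L "ev x" by (rule Lred.poly_reduction_eval[OF x(1)])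
  let ?\<eta> = "e \<circ> \<theta> \<circ> \<iota>"
  have "?\<eta> \<in> Ring.ring_hom RA L"
    by (rule ring_hom_memI) (simp_all add: \<iota>.hom_mult \<iota>.hom_add)
  then interpret \<eta>: ring_hom_ring "RA :: 'k ring" L ?\<eta>
    by (rule ring_hom_ringI2[OF cring.axioms(1)[OF cring_RA] L.ring_axioms])
  have "subring (range ?\<eta>) L"
    using \<eta>.img_is_subring[OF \<eta>.R.carrier_is_subring] by simp
  then obtain p where p: "p \<in> carrier ((range ?\<eta>)[X]\<^bsub>L\<^esub>)" "p \<noteq> []" "L.eval p x = \<zero>\<^bsub>L\<^esub>"
    using L.algebraicE[OF _ x(1)] alg by (auto simp: over_def)
  then have "set p \<subseteq> range ?\<eta>" "hd p \<noteq> \<zero>\<^bsub>L\<^esub>"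
    unfolding univ_poly_carrier[symmetric] polynomial_def by auto
  then obtain l where l: "p = map ?\<eta> l" using ex_map_conv[of p ?\<eta>] by blast
  with p(2) have "l \<noteq> []" by simp
  \<comment> \<open>This keeps \<open>Poly (rev l)\<close> from dropping coefficients, so that its
    coefficient list is \<open>rev l\<close> itself.\<close>
  have "hd l \<noteq> 0"
  proof
    assume "hd l = 0"
    then have "hd p = \<zero>\<^bsub>L\<^esub>" using l \<open>l \<noteq> []\<close> by (simp add: hd_map)
    with \<open>hd p \<noteq> \<zero>\<^bsub>L\<^esub>\<close> show False by simp
  qed
  define g0 where "g0 = Poly (rev l)"
  have "coeffs g0 = rev l"
    unfolding g0_def coeffs_Poly using \<open>l \<noteq> []\<close> \<open>hd l \<noteq> 0\<close>
    by (cases l) simp_all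
  then have ev0: "ev x (map_poly \<iota> g0) = \<zero>\<^bsub>L\<^esub>" and "g0 \<noteq> 0"
    using p(3) l \<open>l \<noteq> []\<close> by (auto simp: polymap_e_\<iota>)
  obtain g where g: "g0 = [:0, 1:] ^ order 0 g0 * g" "\<not> [:0, 1:] dvd g"
    using order_decomp[OF \<open>g0 \<noteq> 0\<close>, of 0] by auto
  have X: "ev x ([:0, 1:] ^ m) \<noteq> \<zero>\<^bsub>L\<^esub>" for m
  proof (induction m)
    case 0
    show ?case unfolding power_0 ev.hom_simps(4) by simp
  next
    case (Suc m)
    have "ev x [:0, 1:] = x" using x(1) by (simp add: polymap_def)
    then show ?case using Suc x ev.hom_simps(1)[of "[:0, 1:] ^ m"] L.integral
      by (metis ev.hom_simps(3) power_Suc)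
  qed
  have "map_poly \<iota> g0 = [:0, 1:] ^ order 0 g0 * map_poly \<iota> g"
    by (subst g(1)) (simp add: mp.hom_mult mp.hom_power map_poly_pCons)
  then have "ev x ([:0, 1:] ^ order 0 g0) \<otimes>\<^bsub>L\<^esub> ev x (map_poly \<iota> g) = \<zero>\<^bsub>L\<^esub>"
    using ev0 by (simp only: ev.hom_simps)
  then have "ev x (map_poly \<iota> g) = \<zero>\<^bsub>L\<^esub>"
    using L.integral ev.hom_simps(1) X by blast
  moreover have "Polynomial.poly g 0 \<noteq> 0" using g(2) poly_eq_0_iff_dvd[of g 0] by simp
  ultimately show ?thesis by (intro that)
qed

lemma roots_transcendental_iff_inverse_mod:
  "(\<forall>x \<in> carrier L. L.eval (map e (polymap \<theta> F)) x = \<zero>\<^bsub>L\<^esub> \<longrightarrow>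
      x = \<zero>\<^bsub>L\<^esub> \<or> L.transcendental (range (e \<circ> \<theta> \<circ> \<iota>)) x) \<longleftrightarrow>
   (\<forall>g. Polynomial.poly g 0 \<noteq> 0 \<longrightarrow> (\<exists>h. in_J (map_poly \<iota> g * h - 1)))"
   (is "?roots \<longleftrightarrow> ?inv")
proof -
  have ev_F: "L.eval (map e (polymap \<theta> F)) x = ev x F" for x
    by (simp add: polymap_def)
  show ?thesis
    unfolding ev_F
  proof (intro iffI allI impI ballI)
    fix g :: "'k poly"
    assume "\<forall>x\<in>carrier L. ev x F = \<zero>\<^bsub>L\<^esub> \<longrightarrow> x = \<zero>\<^bsub>L\<^esub> \<or> L.transcendental (range (e \<circ> \<theta> \<circ> \<iota>)) x"
      and "Polynomial.poly g 0 \<noteq> 0"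
    then show "\<exists>h. in_J (map_poly \<iota> g * h - 1)"
      using bezout_or_common_root[of "map_poly \<iota> g"] algebraic_if_common_root[of _ g] by blast
  next
    fix x
    assume inv: ?inv and x: "x \<in> carrier L" and F: "ev x F = \<zero>\<^bsub>L\<^esub>"
    show "x = \<zero>\<^bsub>L\<^esub> \<or> L.transcendental (range (e \<circ> \<theta> \<circ> \<iota>)) x"
    proof (rule ccontr)
      assume "\<not> ?thesis"
      with x obtain g where g: "Polynomial.poly g 0 \<noteq> 0" "ev x (map_poly \<iota> g) = \<zero>\<^bsub>L\<^esub>"
        using algebraic_nonzero_imp_root by blast
      from inv g(1) obtain h where "in_J (map_poly \<iota> g * h - 1)" by blast
      then have "ev x (map_poly \<iota> g * h - 1) = \<zero>\<^bsub>L\<^esub>" by (rule ev_in_J[OF x F])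
      interpret ev: poly_reduction L "ev x" by (rule Lred.poly_reduction_eval[OF x])
      \<comment> \<open>Adding 1 back gives 1 = g(x) h(x) = 0 in \<open>L\<close>.\<close>
      have "ev x (map_poly \<iota> g * h - 1 + 1) = \<zero>\<^bsub>L\<^esub> \<oplus>\<^bsub>L\<^esub> \<one>\<^bsub>L\<^esub>"
        unfolding ev.hom_simps(2) \<open>ev x (map_poly \<iota> g * h - 1) = \<zero>\<^bsub>L\<^esub>\<close> ev.hom_simps(4) ..
      moreover have "ev x (map_poly \<iota> g * h - 1 + 1) = \<zero>\<^bsub>L\<^esub> \<otimes>\<^bsub>L\<^esub> ev x h"
        using ev.hom_simps(3)[of "map_poly \<iota> g" h] g(2) by simp
      ultimately show False using ev.hom_simps(1)[of h] by simp
    qed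
  qed
qed

end

section \<open>Residue fields of maximal ideals as instances of the reductions\<close>

context
  fixes P :: "'a::comm_ring_1 set"
  assumes P: "maximalideal P RA"
begin

interpretation P: maximalideal P "RA :: 'a ring" by (rule P)

lemma field_resfield: "field (resfield P)"
  unfolding resfield_def by (rule P.quotient_is_field[OF cring_RA])

lemma resmap_hom: "resmap P \<in> Ring.ring_hom RA (resfield P)"
  unfolding resfield_def resmap_def[abs_def] by (rule P.rcos_ring_hom)

lemma resmap_surj: "carrier (resfield P) \<subseteq> range (resmap P)"
  by (auto simp: resfield_def resmap_def FactRing_def A_RCOSETS_def')

lemma resmap_eq_zero_iff: "resmap P a = \<zero>\<^bsub>resfield P\<^esub> \<longleftrightarrow> a \<in> P"
  using P.rcos_const_imp_mem[of a] P.a_rcos_const[of a]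
  by (auto simp: resfield_def resmap_def FactRing_def)

lemma resfield_geometric_reduction:
  fixes \<iota> :: "'k::field \<Rightarrow> 'a"
  assumes "comm_ring_hom \<iota>" "Polynomial.lead_coeff F = 1" "Polynomial.degree F = n"
  shows "geometric_reduction (resfield P) (resmap P) \<iota> F n
    (field.alg_closure (resfield P)) (ring.indexed_const (resfield P))"
proof -
  interpret K: field "resfield P" by (rule field_resfield)
  interpret L: algebraic_closure "field.alg_closure (resfield P)"
    "ring.indexed_const (resfield P) ` carrier (resfield P)"
    by (rule K.alg_closureE(1))
  show ?thesis
    by (intro geometric_reduction.intro residue_reduction.intro poly_reduction.intro
      poly_reduction_axioms.intro residue_reduction_axioms.intro geometric_reduction_axioms.intro
      K.domain_axioms resmap_hom resmap_surj assms field_resfield L.algebraically_closed_axioms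
      K.alg_closureE(2))
qed

end

theorem theorem2p3:
  fixes \<iota> :: "'k::field \<Rightarrow> 'a::comm_ring_1"
    and F :: "'a poly"
    and n :: nat
  assumes hom_one: "\<iota> 1 = 1"
    and hom_add: "\<And>x y. \<iota> (x + y) = \<iota> x + \<iota> y"
    and hom_mult: "\<And>x y. \<iota> (x * y) = \<iota> x * \<iota> y"
    and monic: "Polynomial.lead_coeff F = 1"
    and deg: "Polynomial.degree F = n"
  defines "C1 \<equiv> (\<forall>P. maximalideal P RA \<longrightarrow>
              (let \<kappa> = resfield P; \<phi> = resmap P; L = field.alg_closure \<kappa>;
                   e = ring.indexed_const \<kappa>
               in \<forall>x \<in> carrier L. ring.eval L (map e (polymap \<phi> F)) x = \<zero>\<^bsub>L\<^esub> \<longrightarrow>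
                     x = \<zero>\<^bsub>L\<^esub> \<or> ring.transcendental L (range (e \<circ> \<phi> \<circ> \<iota>)) x))"
    and "C2 \<equiv> (\<forall>g :: 'k poly. Polynomial.poly g 0 \<noteq> 0 \<longrightarrow>
              sF n (uF F n) n (map_poly \<iota> g) dvd 1)"
    and "C3 \<equiv> (\<forall>g :: 'k poly. Polynomial.poly g 0 \<noteq> 0 \<longrightarrow>
              (\<exists>h. F dvd map_poly \<iota> g * h - 1))"
    and "C4 \<equiv> ((\<forall>Z \<in> LQ \<iota> F. \<exists>p. Z = frac_class \<iota> F p 1) \<and>
              (\<forall>p q. frac_class \<iota> F p 1 = frac_class \<iota> F q 1 \<longleftrightarrow> F dvd p - q))"
    and "C5 \<equiv> (\<forall>Z \<in> LQ \<iota> F. \<exists>!c. c \<in> {0..<n} \<rightarrow>\<^sub>E UNIV \<and>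
              Z = frac_class \<iota> F (\<Sum>i<n. Polynomial.monom (c i) i) 1)"
    and "C6 \<equiv> (\<forall>P. maximalideal P RA \<longrightarrow>
              (let \<kappa> = resfield P; \<phi> = resmap P; F\<phi> = polymap \<phi> F
               in \<forall>Z \<in> LQR \<kappa> (\<phi> \<circ> \<iota>) F\<phi>. \<exists>!c. c \<in> {0..<n} \<rightarrow>\<^sub>E carrier \<kappa> \<and>
                    Z = loc_relR \<kappa> (\<phi> \<circ> \<iota>) F\<phi> `` {(poly_of_coeffsR \<kappa> n c, \<one>\<^bsub>poly_ring \<kappa>\<^esub>)}))"
  shows "(C1 \<longleftrightarrow> C2) \<and> (C1 \<longleftrightarrow> C3) \<and> (C1 \<longleftrightarrow> C4) \<and> (C1 \<longleftrightarrow> C5) \<and> (C1 \<longleftrightarrow> C6)"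
proof -
  have "\<iota> 0 = 0" using hom_add[of 0 0] by simp
  then have \<iota>: "comm_ring_hom \<iota>"
    by unfold_locales (simp_all add: hom_one hom_add hom_mult)
  have C23: "C2 \<longleftrightarrow> C3"
    unfolding C2_def C3_def sF_eq_poly_norm[OF monic deg]
    using poly_norm_unit_imp_inverse_mod[OF monic] inverse_mod_imp_poly_norm_unit[OF monic]
    by (intro iffI allI impI) (blast+)
  have C34: "C3 \<longleftrightarrow> C4"
    unfolding C3_def C4_def by (rule inverse_mod_iff_frac_map_iso[OF \<iota>])
  have C45: "C4 \<longleftrightarrow> C5"
    unfolding C4_def C5_def poly_of_coeffs_def[symmetric] by (rule frac_map_iso_iff_basis[OF \<iota> monic deg])
  \<comment> \<open>The common form of \<open>C1\<close> and \<open>C6\<close> at a single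
    \<open>P\<close>: every g with g(0) nonzero is invertible modulo \<open>F\<close> and
    P[x].\<close>
  define inv_at where "inv_at P \<longleftrightarrow> (\<forall>g. Polynomial.poly g 0 \<noteq> 0 \<longrightarrow>
    (\<exists>h q. ideal_poly P (map_poly \<iota> g * h - 1 - F * q)))" for P
  have C3: "C3 \<longleftrightarrow> (\<forall>P. maximalideal P RA \<longrightarrow> inv_at P)"
    unfolding C3_def inverse_mod_iff_maximal[OF monic] inv_at_def by blast
  have at: "(let \<kappa> = resfield P; \<phi> = resmap P; L = field.alg_closure \<kappa>; e = ring.indexed_const \<kappa>
               in \<forall>x \<in> carrier L. ring.eval L (map e (polymap \<phi> F)) x = \<zero>\<^bsub>L\<^esub> \<longrightarrow>
                     x = \<zero>\<^bsub>L\<^esub> \<or> ring.transcendental L (range (e \<circ> \<phi> \<circ> \<iota>)) x) \<longleftrightarrow> inv_at P"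
    "(let \<kappa> = resfield P; \<phi> = resmap P; F\<phi> = polymap \<phi> F
               in \<forall>Z \<in> LQR \<kappa> (\<phi> \<circ> \<iota>) F\<phi>. \<exists>!c. c \<in> {0..<n} \<rightarrow>\<^sub>E carrier \<kappa> \<and>
                    Z = loc_relR \<kappa> (\<phi> \<circ> \<iota>) F\<phi> `` {(poly_of_coeffsR \<kappa> n c, \<one>\<^bsub>poly_ring \<kappa>\<^esub>)}) \<longleftrightarrow> inv_at P"
    if P: "maximalideal P RA" for P
  proof -
    interpret geometric_reduction "resfield P" "resmap P" \<iota> F n
      "field.alg_closure (resfield P)" "ring.indexed_const (resfield P)"
      by (rule resfield_geometric_reduction[OF P \<iota> monic deg])
    \<comment> \<open>This turns \<open>in_J\<close>, defined through the kernel of the residue map,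
      into the congruence modulo \<open>F\<close> and P[x] used in \<open>inv_at\<close>.\<close>
    have "ker = P" by (simp add: resmap_eq_zero_iff[OF P])
    then have inv: "inv_at P \<longleftrightarrow> (\<forall>g. Polynomial.poly g 0 \<noteq> 0 \<longrightarrow> (\<exists>h. in_J (map_poly \<iota> g * h - 1)))"
      by (simp only: inv_at_def in_J_def)
    show "(let \<kappa> = resfield P; \<phi> = resmap P; L = field.alg_closure \<kappa>; e = ring.indexed_const \<kappa>
               in \<forall>x \<in> carrier L. ring.eval L (map e (polymap \<phi> F)) x = \<zero>\<^bsub>L\<^esub> \<longrightarrow>
                     x = \<zero>\<^bsub>L\<^esub> \<or> ring.transcendental L (range (e \<circ> \<phi> \<circ> \<iota>)) x) \<longleftrightarrow> inv_at P"
      unfolding Let_def inv by (rule roots_transcendental_iff_inverse_mod)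
    show "(let \<kappa> = resfield P; \<phi> = resmap P; F\<phi> = polymap \<phi> F
               in \<forall>Z \<in> LQR \<kappa> (\<phi> \<circ> \<iota>) F\<phi>. \<exists>!c. c \<in> {0..<n} \<rightarrow>\<^sub>E carrier \<kappa> \<and>
                    Z = loc_relR \<kappa> (\<phi> \<circ> \<iota>) F\<phi> `` {(poly_of_coeffsR \<kappa> n c, \<one>\<^bsub>poly_ring \<kappa>\<^esub>)}) \<longleftrightarrow> inv_at P"
      unfolding Let_def inv by (rule basis_iff_inverse_mod)
  qed
  have "C1 \<longleftrightarrow> C3" unfolding C1_def C3 using at(1) by simp
  moreover have "C6 \<longleftrightarrow> C3" unfolding C6_def C3 using at(2) by simp
  ultimately show ?thesis using C23 C34 C45 by simp
qed
end
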